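(* In the linear regression setting of the context, let $\mathcal{I}_0=\emptyset,\mathcal{I}_1,\dots,\mathcal{I}_{\bar L}$, with $\bar L=\min(\hat K+1,L)$, be the index sets of the sorted sequentially nested linear model family generated by the S-NER procedure (described in the context), and let $\mathcal{S}$ be the true support. Let $F_1^{-1}$ be the inverse CDF of a central $\chi^2_1$ random variable (one degree of freedom), and assume that the sparse Riesz condition holds: for every $\mathcal{I}\subseteq\{1,\dots,L\}$ with $\mathrm{card}(\mathcal{I})\le\bar L$, $\lim_{n\to\infty}\frac{\mathbf{X}^{\mathcal{I}}(\mathbf{X}^{\mathcal{I}})^T}{n}=\mathbf{M}_{\mathcal{I}}$, where $\mathbf{M}_{\mathcal{I}}$ is a positive definite matrix. For a constant $c_1>0$ let $\delta(n)=c_1(\sigma^2/n)$. Then, for all constants $c,c_1>0$ and every $k\in\{1,2,\dots,\bar L\}$: 1) if $\mathcal{S}\subseteq\mathcal{I}_{k-1}$, then $$\lim_{n\to\infty}\mathbb{P}\Big\{R_{emp}(S_n,\hat{\boldsymbol\theta}_{k-1})-R_{emp}(S_n,\hat{\boldsymbol\theta}_k)\le\tfrac{\sigma^2}{n}\,c\,F_1^{-1}\big(1-c_1(\sigma^2/n)\big)\Big\}=1;$$ 2) if $\mathcal{I}_{k-1}\subset\mathcal{S}$, then $$\lim_{n\to\infty}\mathbb{P}\Big\{R_{emp}(S_n,\hat{\boldsymbol\theta}_{k-1})-R_{emp}(S_n,\hat{\boldsymbol\theta}_k)\ge\tfrac{\sigma^2}{n}\,c\,F_1^{-1}\big(1-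c_1(\sigma^2/n)\big)\Big\}=1.$$
   Context: Data: $S_n=\{(\mathbf{x}_1,y_1),\dots,(\mathbf{x}_n,y_n)\}$, where each $\mathbf{x}_i\in\mathbb{R}^L$ is a vector of $L$ independent features and $y_i\in\mathbb{R}$ is the response, generated by $\mathbf{y}=\mathbf{X}^T\boldsymbol\theta^*+\boldsymbol\varepsilon$. Here $\mathbf{y}=[y_1,\dots,y_n]^T$, $\mathbf{X}=[\mathbf{x}_1,\dots,\mathbf{x}_n]$ is a full-rank $L\times n$ matrix, $\boldsymbol\varepsilon\sim\mathcal{N}(\mathbf{0},\sigma^2\mathbf{I}_n)$ is independent of the features, and $\boldsymbol\theta^*\in\mathbb{R}^L$ is sparse with support $\mathcal{S}=\{j:[\boldsymbol\theta^*]_j\ne0\}$, $\mathrm{card}(\mathcal{S})=K$, $1\le K\le L$. Models and risks: for an index set $\mathcal{I}\subseteq\{1,\dots,L\}$, $\mathbf{x}^{\mathcal{I}}$ is the vector of entries of $\mathbf{x}$ indexed by $\mathcal{I}$ and $\mathbf{X}^{\mathcal{I}}$ is the submatrix of $\mathbf{X}$ formed by the rows indexed by $\mathcal{I}$. The model with index set $\mathcal{I}_k$, $\mathrm{card}(\mathcal{I}_k)=k$, is $\mathcal{M}_k=\{(\mathbf{x}^{\mathcal{I}_k})^T\boldsymbol\theta_k:\boldsymbol\theta_k\in\mathbb{R}^k\}$, and $\mathcal{M}_0=\{\mathbf{x}^T\boldsymbol\theta_0:\boldsymbol\theta_0=\mathbf{0}\}$ with $\mathcal{I}_0=\emptyset$.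 With the squared loss, $R_{emp}(S_n,\boldsymbol\theta_k)=\|\mathbf{y}-(\mathbf{X}^{\mathcal{I}_k})^T\boldsymbol\theta_k\|_2^2/n$. The empirical risk minimizer in $\mathcal{M}_k$ is $\hat{\boldsymbol\theta}_k=(\mathbf{X}^{\mathcal{I}_k}(\mathbf{X}^{\mathcal{I}_k})^T)^{-1}\mathbf{X}^{\mathcal{I}_k}\mathbf{y}$, and $R_{emp}(S_n,\hat{\boldsymbol\theta}_0)=\|\mathbf{y}\|_2^2/n$. S-NER procedure (produces the $\mathcal{I}_k$ from the data): start from $\mathcal{I}_0=\emptyset$. At step $k\ge1$, among the candidate index sets $\mathcal{I}_{k-1}\cup\{j\}$, $j\in\{1,\dots,L\}\setminus\mathcal{I}_{k-1}$, choose the one, $\mathcal{I}_k=\mathcal{I}_{k-1}\cup\{\hat j\}$, whose linear model has the least minimum empirical risk. Accept the expansion if the resulting decrease $R_{emp}(S_n,\hat{\boldsymbol\theta}_{k-1})-R_{emp}(S_n,\hat{\boldsymbol\theta}_k)$ is at least a threshold (taken to be of the form $c\frac{\sigma^2}{n}F_1^{-1}(1-\delta)$, here with $\delta=\delta(n)$). Stop at the first rejection, or when all $L$ features are used. $\hat K$ is the index of the last accepted model; the number of models in the resulting nested family $\{\mathcal{M}_k\}_{k=1}^{\bar L}$ is $\bar L=\min(\hat K+1,L)$, and $\mathcal{I}_{k-1}\subseteq\mathcal{I}_k$. *)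

theory Defs
  imports
    "HOL-Probability.Probability"
    "Jordan_Normal_Form.Gauss_Jordan_Elimination"
    "Jordan_Normal_Form.DL_Rank"
    "Jordan_Normal_Form.DL_Submatrix"
begin

(* Both HOL-Analysis and Jordan_Normal_Form use these symbols; here they belong to the latter. *)
no_notation inner (infix "\<bullet>" 70)
no_notation vec_nth (infixl "$" 90)

section \<open>Inverse CDF of the central chi-square law with one degree of freedom\<close>

definition chi_square_1 :: "real measure" where
  "chi_square_1 = distr std_normal_distribution borel (\<lambda>z. z\<^sup>2)"

(* For 0 < p < 1 this is the inverse of the CDF, which is continuous and strictly increasing on
   the nonnegative reals.  For p \<le> 0, which occurs below only for finitely many sample sizes,
   the value is 0, the left end of the support. *)
definition chi_square_1_inv :: "real \<Rightarrow> real" where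
  "chi_square_1_inv p = Inf {t. 0 \<le> t \<and> p \<le> cdf chi_square_1 t}"

section \<open>Matrix notions\<close>

definition mat_LIMSEQ :: "(nat \<Rightarrow> real mat) \<Rightarrow> real mat \<Rightarrow> bool" where
  "mat_LIMSEQ A B \<longleftrightarrow>
     (\<forall>n. A n \<in> carrier_mat (dim_row B) (dim_col B)) \<and>
     (\<forall>i<dim_row B. \<forall>j<dim_col B. (\<lambda>n. A n $$ (i, j)) \<longlonglongrightarrow> B $$ (i, j))"

definition positive_definite_mat :: "nat \<Rightarrow> real mat \<Rightarrow> bool" where
  "positive_definite_mat k A \<longleftrightarrow>
     A \<in> carrier_mat k k \<and> A\<^sup>T = A \<and>
     (\<forall>v\<in>carrier_vec k. v \<noteq> 0\<^sub>v k \<longrightarrow> 0 < v \<bullet> (A *\<^sub>v v))"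

definition vec_support :: "real vec \<Rightarrow> nat set" where
  "vec_support v = {j. j < dim_vec v \<and> v $ j \<noteq> 0}"

section \<open>Linear models and empirical risk\<close>

(* Features are indexed by 0, ..., L - 1 and samples by 0, 1, 2, ...; the entry x i j is
   feature j of sample i.  Column i of the design matrix is sample i. *)
definition design_mat :: "nat \<Rightarrow> nat \<Rightarrow> (nat \<Rightarrow> nat \<Rightarrow> real) \<Rightarrow> real mat" where
  "design_mat L n x = mat L n (\<lambda>(j, i). x i j)"

definition response_vec :: "real mat \<Rightarrow> real vec \<Rightarrow> (nat \<Rightarrow> real) \<Rightarrow> real vec" where
  "response_vec X \<theta> e = X\<^sup>T *\<^sub>v \<theta> + vec (dim_col X) e"

definition feature_rows :: "real mat \<Rightarrow> nat set \<Rightarrow> real mat" where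
  "feature_rows X I = submatrix X I UNIV"

definition emp_risk :: "real mat \<Rightarrow> real vec \<Rightarrow> nat set \<Rightarrow> real vec \<Rightarrow> real" where
  "emp_risk X y I t =
     (let r = y - (feature_rows X I)\<^sup>T *\<^sub>v t in (r \<bullet> r) / real (dim_vec y))"

(* If the Gram matrix is singular (which full rank excludes once there are at least L samples)
   the estimator is set to the zero vector.  For empty I it is the vector of dimension 0, so
   that the empirical risk is that of the zero model. *)
definition theta_hat :: "real mat \<Rightarrow> real vec \<Rightarrow> nat set \<Rightarrow> real vec" where
  "theta_hat X y I =
     (let Z = feature_rows X I in
      case mat_inverse (Z * Z\<^sup>T) of
        Some B \<Rightarrow> B *\<^sub>v (Z *\<^sub>v y)
      | None \<Rightarrow> 0\<^sub>v (dim_row Z))"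

definition min_emp_risk :: "real mat \<Rightarrow> real vec \<Rightarrow> nat set \<Rightarrow> real" where
  "min_emp_risk X y I = emp_risk X y I (theta_hat X y I)"

section \<open>The S-NER procedure\<close>

(* The greedy path, continued regardless of acceptance; the generated family consists of the
   index sets up to sner_Lbar.  No tie-breaking rule is specified: arg_min_on returns
   some minimizer.  The path is meaningful up to step dim_row X. *)
primrec sner_set :: "real mat \<Rightarrow> real vec \<Rightarrow> nat \<Rightarrow> nat set" where
  "sner_set X y 0 = {}"
| "sner_set X y (Suc k) =
     insert (arg_min_on (\<lambda>j. min_emp_risk X y (insert j (sner_set X y k)))
                        ({..<dim_row X} - sner_set X y k))
            (sner_set X y k)"

definition risk_decrease :: "real mat \<Rightarrow> real vec \<Rightarrow> nat \<Rightarrow> real" where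
  "risk_decrease X y k =
     min_emp_risk X y (sner_set X y (k - 1)) - min_emp_risk X y (sner_set X y k)"

definition sner_threshold :: "real \<Rightarrow> real \<Rightarrow> nat \<Rightarrow> real \<Rightarrow> real" where
  "sner_threshold \<sigma> c n \<delta> = \<sigma>\<^sup>2 / real n * c * chi_square_1_inv (1 - \<delta>)"

(* Index of the last accepted model: stop when all features are used or at the first rejection. *)
definition sner_Khat :: "real mat \<Rightarrow> real vec \<Rightarrow> real \<Rightarrow> nat" where
  "sner_Khat X y \<tau> = (LEAST m. m = dim_row X \<or> risk_decrease X y (Suc m) < \<tau>)"

definition sner_Lbar :: "real mat \<Rightarrow> real vec \<Rightarrow> real \<Rightarrow> nat" where
  "sner_Lbar X y \<tau> = min (sner_Khat X y \<tau> + 1) (dim_row X)"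

end

theory Submission
  imports Defs
begin

text \<open>Let \<open>H\<close> be the squared norm of the projection of the noise onto the span of all features. By
  independence its expectation is at most \<open>\<sigma>\<^sup>2 L\<close>, so \<open>H\<close> is bounded in probability. If the current
  model contains the support, a further step decreases the residual sum of squares by at most \<open>H\<close>,
  while \<open>n\<close> times the threshold tends to infinity. If the current model is strictly contained in the
  support, the residual is strongly correlated with some missing feature, and the greedy choice
  decreases the empirical risk by an amount bounded below, while the threshold tends to 0.

  The second part needs the limit of the full Gram matrix, whereas the sparse Riesz condition only
  concerns index sets no larger than some attained \<open>Lbar\<close>. Conditionally on the features, however,
  the noise makes the procedure accept all \<open>L\<close> features at sample size \<open>L\<close> with positive probability;
  since the convergence of the Gram matrix depends on the features only, it holds almost surely.\<close>

section \<open>Empirical risk minimizers as least squares fits\<close>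

text \<open>The index sets depend on the noise, so the chi-square law that a single decrease would
  have for a fixed index set is not at hand. Instead, all bounds hold for every index set at once:
  the noise enters only through its projection onto the span of all features, whose expected squared
  norm is \<open>\<sigma>\<^sup>2\<close> times the expected trace of the projection matrix, and
  that trace is at most \<open>L\<close>. Two rates of the quantile at level
  \<open>1 - c\<^sub>1 * (\<sigma>\<^sup>2 / real n)\<close> suffice. It diverges, because the
  chi-square law has unbounded support; it is o(n), by a moment bound. Hence \<open>n\<close> times
  the threshold diverges and the threshold vanishes, whatever the constants are. No eigenvalues
  occur. The trace of the Gram matrix bounds the squared norms of the features, and the trace of its
  inverse bounds coefficients in terms of fitted values. Inverses are written with the adjugate, so
  that both measurability and convergence reduce to determinants.\<close>

definition lin_fit :: "nat \<Rightarrow> (nat \<Rightarrow> nat \<Rightarrow> real) \<Rightarrow> (nat \<Rightarrow> real) \<Rightarrow> nat \<Rightarrow> real" where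
  "lin_fit L x v i = (\<Sum>j<L. v j * x i j)"

text \<open>This is injectivity of the transposed design matrix. Coefficients are functions on
  \<open>nat\<close> of which only the values below \<open>L\<close> matter, so models with
  different index sets share one parameter space.\<close>

definition full_row_rank :: "nat \<Rightarrow> nat \<Rightarrow> (nat \<Rightarrow> nat \<Rightarrow> real) \<Rightarrow> bool" where
  "full_row_rank L n x \<longleftrightarrow> (\<forall>v. (\<forall>i<n. lin_fit L x v i = 0) \<longrightarrow> (\<forall>j<L. v j = 0))"

text \<open>A maximal independent set of columns has \<open>n\<close> elements and forms a square
  matrix with nonzero determinant; \<open>v\<close> lies in the kernel of its transpose.\<close>

lemma (in vec_space) full_rank_orthogonal_zero:
  fixes v :: "'a vec"
  assumes A: "A \<in> carrier_mat n nc" and r: "rank A = n" and v: "v \<in> carrier_vec n"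
    and orth: "\<And>w. w \<in> set (cols A) \<Longrightarrow> w \<bullet> v = 0"
  shows "v = 0\<^sub>v n"
proof -
  obtain U where U: "maximal U (\<lambda>T. T \<subseteq> set (cols A) \<and> lin_indpt T)"
    using maximal_exists[of "(\<lambda>T. T \<subseteq> set (cols A) \<and> lin_indpt T)" "card (set (cols A))" "{}"]
    by (meson List.finite_set card_mono empty_iff empty_subsetI finite_lin_indpt2 rev_finite_subset)
  have UA: "U \<subseteq> set (cols A)" and Ui: "lin_indpt U" using U by (auto simp: maximal_def)
  have fU: "finite U" using UA by (simp add: finite_subset)
  have cU: "card U = n" using rank_card_indpt[OF A U] r by simp
  have Uc: "U \<subseteq> carrier_vec n" using UA A cols_dim by blast
  obtain us where us: "set us = U" "distinct us" using fU finite_distinct_list by blast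
  have len: "length us = n" using us cU distinct_card by fastforce
  define B where "B = mat_of_cols n us"
  have cB: "cols B = us" unfolding B_def using us Uc by (simp add: cols_mat_of_cols)
  have B: "B \<in> carrier_mat n n" unfolding B_def using len by auto
  have "rank B = n" using lin_indpt_full_rank[OF B] us Ui cB by simp
  then have "det B \<noteq> 0" using det_rank_iff[OF B] by simp
  then have dT: "det B\<^sup>T \<noteq> 0" using det_transpose[OF B] by simp
  have "B\<^sup>T *\<^sub>v v = 0\<^sub>v n"
  proof (rule eq_vecI)
    fix i assume i: "i < dim_vec (0\<^sub>v n :: 'a vec)"
    have "col B i \<in> set (cols A)" using UA us cB i B by (metis carrier_matD(2) cols_length cols_nth index_zero_vec(2) nth_mem subsetD)
    then show "(B\<^sup>T *\<^sub>v v) $ i = 0\<^sub>v n $ i" using i B orth by auto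
  qed (use B in auto)
  then show ?thesis using dT det_0_iff_vec_prod_zero_field[of "B\<^sup>T" n] B v by auto
qed

lemma full_row_rank_design_mat:
  assumes "vec_space.rank L (design_mat L n x) = L"
  shows "full_row_rank L n x"
  unfolding full_row_rank_def
proof (intro allI impI)
  fix v :: "nat \<Rightarrow> real" and j assume 0: "\<forall>i<n. lin_fit L x v i = 0" and j: "j < L"
  have X: "design_mat L n x \<in> carrier_mat L n" by (simp add: design_mat_def)
  have "vec L v = 0\<^sub>v L"
  proof (rule vec_space.full_rank_orthogonal_zero[OF X assms])
    fix w assume "w \<in> set (cols (design_mat L n x))"
    then obtain i where i: "i < n" "w = col (design_mat L n x) i"
      using X by (auto simp: cols_def)
    then have "w \<bullet> vec L v = lin_fit L x v i"
      by (auto simp: scalar_prod_def lin_fit_def design_mat_def lessThan_atLeast0 mult.commute intro!: sum.cong)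
    then show "w \<bullet> vec L v = 0" using 0 i by simp
  qed simp
  then show "v j = 0" using j by (metis index_vec index_zero_vec(1))
qed

text \<open>\<open>pick I\<close> enumerates \<open>I\<close> increasingly and its inverse counts
  the smaller elements. This turns sums over the rows of a submatrix into sums over
  features.\<close>

lemma sum_pick:
  fixes f :: "nat \<Rightarrow> nat \<Rightarrow> real"
  assumes "finite I"
  shows "(\<Sum>a<card I. f (pick I a) a) = (\<Sum>j\<in>I. f j (card {a\<in>I. a < j}))"
proof (rule sum.reindex_bij_witness[where i="\<lambda>j. card {a\<in>I. a < j}" and j="pick I"])
  fix a assume a: "a \<in> {..<card I}"
  then show "card {b\<in>I. b < pick I a} = a" by (simp add: card_pick_le)
  then show "f (pick I a) (card {b\<in>I. b < pick I a}) = f (pick I a) a" by simp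
  show "pick I a \<in> I" using a pick_in_set_le by simp
next
  fix j assume j: "j \<in> I"
  then show "pick I (card {a\<in>I. a < j}) = j" by (simp add: pick_card_in_set)
  have "{a\<in>I. a < j} \<subset> I" using j by auto
  then show "card {a\<in>I. a < j} \<in> {..<card I}" using assms by (simp add: psubset_card_mono)
qed

lemma feature_rows_carrier:
  "feature_rows (design_mat L n x) I \<in> carrier_mat (card {i. i < L \<and> i \<in> I}) n"
  by (simp add: feature_rows_def submatrix_def design_mat_def)

lemma feature_rows_index:
  assumes "a < card {i. i < L \<and> i \<in> I}" "i < n"
  shows "feature_rows (design_mat L n x) I $$ (a, i) = x i (pick I a)"
proof -
  have "pick I a < L" using assms(1) by (rule pick_le)
  then show ?thesis using assms
    by (simp add: feature_rows_def submatrix_def design_mat_def pick_UNIV)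
qed

lemma feature_rows_all: "feature_rows (design_mat L n x) {..<L} = design_mat L n x"
proof (rule eq_matI)
  have *: "{i. i < L \<and> i \<in> {..<L}} = {..<L}" by auto
  fix a i assume "a < dim_row (design_mat L n x)" "i < dim_col (design_mat L n x)"
  then have ai: "a < L" "i < n" by (auto simp: design_mat_def)
  have "card {b\<in>{..<L}. b < a} = a"
  proof -
    have "{b\<in>{..<L}. b < a} = {..<a}" using ai by auto
    then show ?thesis by simp
  qed
  then have "pick {..<L} a = a" using pick_card_in_set[of a "{..<L}"] ai by simp
  then show "feature_rows (design_mat L n x) {..<L} $$ (a, i) = design_mat L n x $$ (a, i)"
    using feature_rows_index[of a L "{..<L}" i n x] ai * by (simp add: design_mat_def)
qed (auto simp: feature_rows_def submatrix_def design_mat_def)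

text \<open>Feature \<open>j \<in> I\<close> is row \<open>card {a\<in>I. a < j}\<close> of \<open>feature_rows X I\<close>.\<close>
definition embed_coeffs :: "nat set \<Rightarrow> real vec \<Rightarrow> nat \<Rightarrow> real" where
  "embed_coeffs I w j = (if j \<in> I then w $ (card {a\<in>I. a < j}) else 0)"

lemma feature_rows_transpose_mult:
  assumes I: "I \<subseteq> {..<L}" and w: "w \<in> carrier_vec (card I)"
  shows "(feature_rows (design_mat L n x) I)\<^sup>T *\<^sub>v w = vec n (lin_fit L x (embed_coeffs I w))"
proof (rule eq_vecI)
  have eqI: "{i. i < L \<and> i \<in> I} = I" using I by auto
  note c = feature_rows_carrier[of L n x I, unfolded eqI]
  have fin: "finite I" using I finite_subset by blast
  fix i assume "i < dim_vec (vec n (lin_fit L x (embed_coeffs I w)))"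
  then have i: "i < n" by simp
  have "((feature_rows (design_mat L n x) I)\<^sup>T *\<^sub>v w) $ i = (\<Sum>a<card I. feature_rows (design_mat L n x) I $$ (a, i) * w $ a)"
    using c i w by (auto simp: scalar_prod_def lessThan_atLeast0)
  also have "\<dots> = (\<Sum>a<card I. x i (pick I a) * w $ a)"
    using i by (intro sum.cong refl) (simp add: feature_rows_index eqI)
  also have "\<dots> = (\<Sum>j\<in>I. embed_coeffs I w j * x i j)"
    by (subst sum_pick[OF fin]) (auto simp: embed_coeffs_def intro!: sum.cong)
  also have "\<dots> = lin_fit L x (embed_coeffs I w) i"
    unfolding lin_fit_def using I by (intro sum.mono_neutral_left) (auto simp: embed_coeffs_def)
  finally show "((feature_rows (design_mat L n x) I)\<^sup>T *\<^sub>v w) $ i = vec n (lin_fit L x (embed_coeffs I w)) $ i"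
    using i by simp
qed (auto simp: feature_rows_def submatrix_def design_mat_def)

text \<open>If the Gram matrix annihilates \<open>w\<close>, then the squared norm of
  \<open>Z\<^sup>T *\<^sub>v w\<close> is zero. So the fit with the coefficients \<open>w\<close>,
  extended by zero to all features, vanishes, and full row rank forces \<open>w\<close> to be
  zero.\<close>

lemma det_gram_nonzero:
  assumes fr: "full_row_rank L n x" and I: "I \<subseteq> {..<L}"
  defines "Z \<equiv> feature_rows (design_mat L n x) I"
  shows "det (Z * Z\<^sup>T) \<noteq> 0"
proof
  assume d: "det (Z * Z\<^sup>T) = 0"
  have eqI: "{i. i < L \<and> i \<in> I} = I" using I by auto
  have Z: "Z \<in> carrier_mat (card I) n" unfolding Z_def using feature_rows_carrier[of L n x I] eqI by simp
  have G: "Z * Z\<^sup>T \<in> carrier_mat (card I) (card I)" using Z by simp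
  obtain w where w: "w \<in> carrier_vec (card I)" "w \<noteq> 0\<^sub>v (card I)" "(Z * Z\<^sup>T) *\<^sub>v w = 0\<^sub>v (card I)"
    using d det_0_iff_vec_prod_zero_field[OF G] by auto
  define u where "u = Z\<^sup>T *\<^sub>v w"
  have u: "u \<in> carrier_vec n" unfolding u_def using Z w(1) by (metis mult_mat_vec_carrier transpose_carrier_mat)
  have "u \<bullet> u = w \<bullet> (Z *\<^sub>v u)"
    using transpose_vec_mult_scalar[OF Z u w(1)] unfolding u_def by simp
  also have "Z *\<^sub>v u = 0\<^sub>v (card I)" using w Z unfolding u_def by (metis assoc_mult_mat_vec transpose_carrier_mat)
  finally have "u \<bullet> u = 0" using w by simp
  then have "u = 0\<^sub>v n" using conjugate_square_eq_0_vec[OF u] by simp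
  then have "vec n (lin_fit L x (embed_coeffs I w)) = 0\<^sub>v n"
    using feature_rows_transpose_mult[OF I w(1)] unfolding u_def Z_def by simp
  then have "\<forall>i<n. lin_fit L x (embed_coeffs I w) i = 0" by (metis index_vec index_zero_vec(1))
  then have z: "\<And>j. j < L \<Longrightarrow> embed_coeffs I w j = 0" using fr unfolding full_row_rank_def by blast
  have "w = 0\<^sub>v (card I)"
  proof (rule eq_vecI)
    fix a assume a: "a < dim_vec (0\<^sub>v (card I) :: real vec)"
    then have "pick I a \<in> I" "card {b\<in>I. b < pick I a} = a" using pick_in_set_le card_pick_le by auto
    then show "w $ a = 0\<^sub>v (card I) $ a" using z[of "pick I a"] I a by (auto simp: embed_coeffs_def)
  qed (use w in auto)
  then show False using w by simp
qed

definition residual_ss :: "nat \<Rightarrow> nat \<Rightarrow> (nat \<Rightarrow> nat \<Rightarrow> real) \<Rightarrow> (nat \<Rightarrow> real) \<Rightarrow> (nat \<Rightarrow> real) \<Rightarrow> real" where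
  "residual_ss L n x y v = (\<Sum>i<n. (y i - lin_fit L x v i)\<^sup>2)"

text \<open>This is the passage from matrices to sums: the risk bounds below know the estimator only
  through these three facts, in particular the orthogonality of its residual to the features in
  \<open>I\<close>.\<close>

lemma min_emp_risk_normal_equations:
  assumes fr: "full_row_rank L n x" and I: "I \<subseteq> {..<L}"
  obtains b where "\<And>j. j \<notin> I \<Longrightarrow> b j = 0"
    and "min_emp_risk (design_mat L n x) (vec n y) I = residual_ss L n x y b / real n"
    and "\<And>j. j \<in> I \<Longrightarrow> (\<Sum>i<n. x i j * (y i - lin_fit L x b i)) = 0"
proof -
  define Z where "Z = feature_rows (design_mat L n x) I"
  have eqI: "{i. i < L \<and> i \<in> I} = I" using I by auto
  have fin: "finite I" using I finite_subset by blast
  have Z: "Z \<in> carrier_mat (card I) n" unfolding Z_def using feature_rows_carrier[of L n x I] eqI by simp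
  have G: "Z * Z\<^sup>T \<in> carrier_mat (card I) (card I)" using Z by simp
  have "mat_inverse (Z * Z\<^sup>T) \<noteq> None"
    using mat_inverse(1)[OF G, where b = "()"] det_non_zero_imp_unit[OF G det_gram_nonzero[OF fr I, folded Z_def], where b = "()"] by auto
  then obtain B where iB: "mat_inverse (Z * Z\<^sup>T) = Some B" by auto
  note B = mat_inverse(2)[OF G iB]
  define t where "t = B *\<^sub>v (Z *\<^sub>v vec n y)"
  have t: "theta_hat (design_mat L n x) (vec n y) I = t"
    unfolding theta_hat_def Let_def Z_def[symmetric] iB t_def by simp
  have tc: "t \<in> carrier_vec (card I)" unfolding t_def using B Z by auto
  define b where "b = embed_coeffs I t"
  have ft: "Z\<^sup>T *\<^sub>v t = vec n (lin_fit L x b)"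
    unfolding Z_def b_def by (rule feature_rows_transpose_mult[OF I tc])
  have Zy: "Z *\<^sub>v vec n y \<in> carrier_vec (card I)" using Z by auto
  have "Z *\<^sub>v (Z\<^sup>T *\<^sub>v t) = (Z * Z\<^sup>T) *\<^sub>v t" using Z tc by (simp add: assoc_mult_mat_vec)
  also have "\<dots> = ((Z * Z\<^sup>T) * B) *\<^sub>v (Z *\<^sub>v vec n y)"
    unfolding t_def using B G Zy by (intro assoc_mult_mat_vec[symmetric]) auto
  also have "\<dots> = Z *\<^sub>v vec n y" using B Zy by simp
  finally have ne: "Z *\<^sub>v vec n (lin_fit L x b) = Z *\<^sub>v vec n y" unfolding ft .
  show thesis
  proof (rule that)
    show "b j = 0" if "j \<notin> I" for j using that by (simp add: b_def embed_coeffs_def)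
    show "min_emp_risk (design_mat L n x) (vec n y) I = residual_ss L n x y b / real n"
      unfolding min_emp_risk_def t emp_risk_def Let_def Z_def[symmetric] ft
      by (simp add: scalar_prod_def residual_ss_def power2_eq_square lessThan_atLeast0)
    fix j assume j: "j \<in> I"
    define a where "a = card {b\<in>I. b < j}"
    have pa: "pick I a = j" unfolding a_def using j by (simp add: pick_card_in_set)
    have "{a\<in>I. a < j} \<subset> I" using j by auto
    then have a: "a < card I" using fin by (simp add: a_def psubset_card_mono)
    have "(Z *\<^sub>v vec n f) $ a = (\<Sum>i<n. x i j * f i)" for f
    proof -
      have "(Z *\<^sub>v vec n f) $ a = (\<Sum>i<n. Z $$ (a, i) * f i)"
        using Z a by (auto simp: scalar_prod_def lessThan_atLeast0)
      also have "\<dots> = (\<Sum>i<n. x i j * f i)"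
        unfolding Z_def using a pa by (intro sum.cong refl) (simp add: feature_rows_index eqI)
      finally show ?thesis .
    qed
    then have "(\<Sum>i<n. x i j * lin_fit L x b i) = (\<Sum>i<n. x i j * y i)" using ne by metis
    then show "(\<Sum>i<n. x i j * (y i - lin_fit L x b i)) = 0"
      by (simp add: right_diff_distrib sum_subtractf)
  qed
qed

section \<open>Bounds on the decrease of the empirical risk\<close>

lemma lin_fit_diff: "lin_fit L x (\<lambda>j. v j - w j) i = lin_fit L x v i - lin_fit L x w i"
  by (simp add: lin_fit_def left_diff_distrib sum_subtractf)

lemma sum_lin_fit_mult:
  "(\<Sum>i<n. lin_fit L x v i * r i) = (\<Sum>j<L. v j * (\<Sum>i<n. x i j * r i))"
proof -
  have "(\<Sum>i<n. lin_fit L x v i * r i) = (\<Sum>i<n. \<Sum>j<L. v j * (x i j * r i))"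
    unfolding lin_fit_def sum_distrib_right by (simp add: mult.assoc)
  also have "\<dots> = (\<Sum>j<L. \<Sum>i<n. v j * (x i j * r i))" by (rule sum.swap)
  finally show ?thesis by (simp add: sum_distrib_left)
qed

lemma sum_square_add:
  fixes a b :: "nat \<Rightarrow> real"
  shows "(\<Sum>i<n. (a i + b i)\<^sup>2) = (\<Sum>i<n. (a i)\<^sup>2) + 2 * (\<Sum>i<n. a i * b i) + (\<Sum>i<n. (b i)\<^sup>2)"
  by (simp add: power2_sum sum.distrib sum_distrib_left mult_ac)

text \<open>Pythagoras: the residual of \<open>b\<close> is orthogonal to the fit of
  \<open>b - w\<close>, because this difference is supported on \<open>I\<close>.\<close>

lemma residual_ss_minimal:
  assumes b: "\<And>j. j \<notin> I \<Longrightarrow> b j = 0" and w: "\<And>j. j \<notin> I \<Longrightarrow> j < L \<Longrightarrow> w j = 0"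
    and ne: "\<And>j. j \<in> I \<Longrightarrow> (\<Sum>i<n. x i j * (y i - lin_fit L x b i)) = 0"
  shows "residual_ss L n x y b \<le> residual_ss L n x y w"
proof -
  let ?u = "\<lambda>j. b j - w j"
  let ?r = "\<lambda>i. y i - lin_fit L x b i"
  have "(\<Sum>i<n. ?r i * lin_fit L x ?u i) = (\<Sum>j<L. ?u j * (\<Sum>i<n. x i j * ?r i))"
    using sum_lin_fit_mult[of L x ?u ?r n] by (simp add: mult.commute)
  also have "\<dots> = 0"
  proof (intro sum.neutral ballI)
    fix j assume "j \<in> {..<L}"
    then show "?u j * (\<Sum>i<n. x i j * ?r i) = 0" using b w ne by (cases "j \<in> I") auto
  qed
  finally have 0: "(\<Sum>i<n. ?r i * lin_fit L x ?u i) = 0" .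
  have "residual_ss L n x y w = (\<Sum>i<n. (?r i + lin_fit L x ?u i)\<^sup>2)"
    by (simp add: residual_ss_def lin_fit_diff)
  also have "\<dots> = residual_ss L n x y b + (\<Sum>i<n. (lin_fit L x ?u i)\<^sup>2)"
    unfolding sum_square_add 0 by (simp add: residual_ss_def)
  finally show ?thesis by (simp add: sum_nonneg)
qed

lemma min_emp_risk_le_residual_ss:
  assumes "full_row_rank L n x" "I \<subseteq> {..<L}" "\<And>j. j \<notin> I \<Longrightarrow> j < L \<Longrightarrow> w j = 0"
  shows "min_emp_risk (design_mat L n x) (vec n y) I \<le> residual_ss L n x y w / real n"
proof -
  obtain b where "\<And>j. j \<notin> I \<Longrightarrow> b j = 0"
    "min_emp_risk (design_mat L n x) (vec n y) I = residual_ss L n x y b / real n"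
    "\<And>j. j \<in> I \<Longrightarrow> (\<Sum>i<n. x i j * (y i - lin_fit L x b i)) = 0"
    using min_emp_risk_normal_equations[OF assms(1,2), of y] by blast
  then show ?thesis using residual_ss_minimal[where I=I and b=b and w=w and L=L and n=n and x=x and y=y] assms(3) by (simp add: divide_right_mono)
qed

text \<open>\<open>H\<close> bounds the energy of the noise inside the span of the features: the largest value of
  \<open>(u \<bullet> e)\<^sup>2 / (u \<bullet> u)\<close> over fitted vectors \<open>u\<close> is the squared norm of the projection of \<open>e\<close>.\<close>
definition span_energy_le :: "nat \<Rightarrow> nat \<Rightarrow> (nat \<Rightarrow> nat \<Rightarrow> real) \<Rightarrow> (nat \<Rightarrow> real) \<Rightarrow> real \<Rightarrow> bool" where
  "span_energy_le L n x e H \<longleftrightarrow>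
     (\<forall>v. (\<Sum>i<n. lin_fit L x v i * e i)\<^sup>2 \<le> H * (\<Sum>i<n. (lin_fit L x v i)\<^sup>2))"

text \<open>The true coefficients are admissible for \<open>I\<close>, so the risk of
  \<open>I\<close> is at most the mean square of \<open>e\<close>. Any other fit differs from the
  true one by some \<open>u\<close> of squared norm \<open>A\<close> and has residual sum of squares
  \<open>A + 2 * C\<close> plus that of \<open>e\<close>; since \<open>\<bar>C\<bar>\<close> is at
  most \<open>sqrt H * sqrt A\<close>, the gain \<open>- A - 2 * C\<close> never exceeds
  \<open>H\<close>. The bound is the same for all pairs \<open>I\<close>, \<open>J\<close>, so they
  may be chosen from the data.\<close>

lemma min_emp_risk_decrease_le:
  assumes fr: "full_row_rank L n x" and IJ: "I \<subseteq> {..<L}" "J \<subseteq> {..<L}"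
    and th: "\<And>j. j < L \<Longrightarrow> j \<notin> I \<Longrightarrow> \<theta> j = 0"
    and y: "\<And>i. y i = lin_fit L x \<theta> i + e i"
    and H: "span_energy_le L n x e H" "0 \<le> H" and n: "0 < n"
  shows "min_emp_risk (design_mat L n x) (vec n y) I - min_emp_risk (design_mat L n x) (vec n y) J \<le> H / real n"
proof -
  obtain b where b: "min_emp_risk (design_mat L n x) (vec n y) J = residual_ss L n x y b / real n"
    using min_emp_risk_normal_equations[OF fr IJ(2), of y] by blast
  have 1: "min_emp_risk (design_mat L n x) (vec n y) I \<le> residual_ss L n x y \<theta> / real n"
    by (rule min_emp_risk_le_residual_ss[OF fr IJ(1) th])
  let ?u = "lin_fit L x (\<lambda>j. \<theta> j - b j)"
  define A where "A = (\<Sum>i<n. (?u i)\<^sup>2)"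
  define C where "C = (\<Sum>i<n. ?u i * e i)"
  have "C\<^sup>2 \<le> H * A" using H(1) unfolding span_energy_le_def A_def C_def by blast
  have A0: "0 \<le> A" unfolding A_def by (simp add: sum_nonneg)
  have "\<bar>C\<bar> \<le> sqrt H * sqrt A" using \<open>C\<^sup>2 \<le> H * A\<close> by (metis real_sqrt_abs real_sqrt_le_iff real_sqrt_mult)
  moreover have "0 \<le> (sqrt H - sqrt A)\<^sup>2" by simp
  then have "2 * (sqrt H * sqrt A) \<le> H + A" using H(2) A0 by (simp add: power2_diff)
  ultimately have "- (2 * C) \<le> H + A" by linarith
  moreover have "residual_ss L n x y b = A + 2 * C + residual_ss L n x y \<theta>"
  proof -
    have "residual_ss L n x y b = (\<Sum>i<n. (?u i + e i)\<^sup>2)"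
      unfolding residual_ss_def lin_fit_diff y by (simp add: algebra_simps)
    moreover have "residual_ss L n x y \<theta> = (\<Sum>i<n. (e i)\<^sup>2)" unfolding residual_ss_def y by simp
    ultimately show ?thesis unfolding sum_square_add A_def C_def by simp
  qed
  ultimately have "residual_ss L n x y \<theta> - residual_ss L n x y b \<le> H" by linarith
  then have "residual_ss L n x y \<theta> / real n - residual_ss L n x y b / real n \<le> H / real n"
    by (metis diff_divide_distrib divide_right_mono of_nat_0_le_iff)
  then show ?thesis using 1 b by linarith
qed

text \<open>Dividing by \<open>L\<close> instead of \<open>card A\<close> gives a constant that is
  the same for every index set.\<close>

lemma exists_term_ge_average:
  fixes f :: "nat \<Rightarrow> real"
  assumes "finite A" "card A \<le> L" "0 < L" "0 < q" "q \<le> sum f A"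
  shows "\<exists>j\<in>A. q / real L \<le> f j"
proof (rule ccontr)
  assume "\<not> ?thesis"
  then have *: "\<And>j. j \<in> A \<Longrightarrow> f j < q / real L" by force
  have "A \<noteq> {}" using assms by auto
  have "sum f A < (\<Sum>j\<in>A. q / real L)" using * assms(1) \<open>A \<noteq> {}\<close> by (intro sum_strict_mono) auto
  also have "\<dots> = real (card A) * (q / real L)" by simp
  also have "\<dots> \<le> real L * (q / real L)" using assms by (intro mult_right_mono) auto
  finally show False using assms by simp
qed

text \<open>The residual \<open>r\<close> of the model \<open>I\<close> is \<open>u + e\<close> with \<open>u\<close> in the span of the features and
  orthogonal to the features in \<open>I\<close>, so the missing features satisfy
  \<open>\<Sum>j\<in>S - I. \<theta> j * (x j \<bullet> r) = u \<bullet> r\<close>, which is large; a step along the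
  best \<open>x j\<close> then decreases the risk.\<close>
lemma min_emp_risk_decrease_ge:
  assumes fr: "full_row_rank L n x" and S: "S \<subseteq> {..<L}" and I: "I \<subset> S"
    and th: "\<And>j. j < L \<Longrightarrow> j \<notin> S \<Longrightarrow> \<theta> j = 0"
    and ab: "\<And>j. j \<in> S \<Longrightarrow> a \<le> \<bar>\<theta> j\<bar>" "\<And>j. j \<in> S \<Longrightarrow> \<bar>\<theta> j\<bar> \<le> b" "0 < a"
    and y: "\<And>i. y i = lin_fit L x \<theta> i + e i"
    and H: "span_energy_le L n x e H" "0 \<le> H"
    and g: "\<And>v j. j < L \<Longrightarrow> (v j)\<^sup>2 \<le> g * (\<Sum>i<n. (lin_fit L x v i)\<^sup>2)" "0 < g"
    and B: "\<And>j. j < L \<Longrightarrow> (\<Sum>i<n. (x i j)\<^sup>2) \<le> B" "0 < B"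
    and small: "4 * H * g \<le> a\<^sup>2" and n: "0 < n"
  shows "\<exists>j\<in>S - I. (a\<^sup>2 / (2 * g * real L * b))\<^sup>2 / B / real n
     \<le> min_emp_risk (design_mat L n x) (vec n y) I
       - min_emp_risk (design_mat L n x) (vec n y) (insert j I)"
proof -
  have IL: "I \<subseteq> {..<L}" using S I by auto
  obtain j0 where j0: "j0 \<in> S" "j0 \<notin> I" using I by auto
  have L: "0 < L" using j0 S by auto
  have b0: "0 < b" using ab j0 by force
  obtain \<beta> where \<beta>: "\<And>j. j \<notin> I \<Longrightarrow> \<beta> j = 0"
    and R: "min_emp_risk (design_mat L n x) (vec n y) I = residual_ss L n x y \<beta> / real n"
    and ne: "\<And>j. j \<in> I \<Longrightarrow> (\<Sum>i<n. x i j * (y i - lin_fit L x \<beta> i)) = 0"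
    using min_emp_risk_normal_equations[OF fr IL, of y] by blast
  define r where "r i = y i - lin_fit L x \<beta> i" for i
  define v where "v j = \<theta> j - \<beta> j" for j
  let ?u = "lin_fit L x v"
  define A where "A = (\<Sum>i<n. (?u i)\<^sup>2)"
  define C where "C = (\<Sum>i<n. ?u i * e i)"
  define c where "c j = (\<Sum>i<n. x i j * r i)" for j
  have ru: "r i = ?u i + e i" for i unfolding r_def y v_def lin_fit_diff by simp
  have "C\<^sup>2 \<le> H * A" using H(1) unfolding span_energy_le_def A_def C_def by blast
  have "v j0 = \<theta> j0" using \<beta> j0 by (simp add: v_def)
  then have "a\<^sup>2 \<le> (v j0)\<^sup>2" using ab(1)[OF j0(1)] ab(3) by (metis abs_le_square_iff abs_of_pos)
  also have "\<dots> \<le> g * A" unfolding A_def using g(1) j0 S by blast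
  finally have gA: "a\<^sup>2 \<le> g * A" .
  have A0: "0 < A" 
  proof (rule ccontr)
    assume "\<not> ?thesis"
    then have "g * A \<le> 0" using g(2) by (simp add: mult_nonneg_nonpos)
    moreover have "0 < a\<^sup>2" using ab(3) by simp
    ultimately show False using gA by linarith
  qed
  \<comment> \<open>The unexplained signal has at least four times the energy of the projected
    noise. With \<open>C\<^sup>2 \<le> H * A\<close> this gives
    \<open>\<bar>C\<bar> \<le> A / 2\<close>, so the correlation \<open>A + C\<close> of
    \<open>u\<close> with the residual is at least \<open>A / 2\<close>.\<close>
  have "4 * H \<le> A"
  proof -
    have "4 * H * g \<le> A * g" using small gA by (simp add: mult.commute)
    then show ?thesis using g(2) by simp
  qed
  have "4 * H * A \<le> A * A" using \<open>4 * H \<le> A\<close> A0 by (intro mult_right_mono) auto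
  then have "4 * C\<^sup>2 \<le> A\<^sup>2" 
    using \<open>C\<^sup>2 \<le> H * A\<close> unfolding power2_eq_square[of A] by linarith
  then have "(2 * C)\<^sup>2 \<le> A\<^sup>2" by (simp add: power_mult_distrib)
  then have "\<bar>2 * C\<bar> \<le> A" using A0 abs_le_square_iff[of "2 * C" A] by simp
  have "(\<Sum>j\<in>S - I. \<theta> j * c j) = (\<Sum>j<L. v j * c j)"
  proof -
    have "(\<Sum>j<L. v j * c j) = (\<Sum>j\<in>S - I. v j * c j)"
    proof (rule sum.mono_neutral_right)
      show "\<forall>j\<in>{..<L} - (S - I). v j * c j = 0"
      proof
        fix j assume j: "j \<in> {..<L} - (S - I)"
        show "v j * c j = 0"
        proof (cases "j \<in> I")
          case True
          then show ?thesis using ne by (simp add: c_def r_def)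
        next
          case False
          then show ?thesis using j th \<beta> by (simp add: v_def)
        qed
      qed
    qed (use S in auto)
    then show ?thesis using \<beta> by (simp add: v_def)
  qed
  also have "\<dots> = (\<Sum>i<n. ?u i * r i)" unfolding c_def sum_lin_fit_mult ..
  also have "\<dots> = A + C" unfolding ru A_def C_def by (simp add: distrib_left sum.distrib power2_eq_square)
  finally have "A / 2 \<le> (\<Sum>j\<in>S - I. \<theta> j * c j)" using \<open>\<bar>2 * C\<bar> \<le> A\<close> by linarith
  moreover have "finite (S - I)" "card (S - I) \<le> L"
    using S finite_subset card_mono[of "{..<L}" "S - I"] by auto
  ultimately obtain j where j: "j \<in> S - I" "(A / 2) / real L \<le> \<theta> j * c j"
    using exists_term_ge_average[of "S - I" L "A / 2" "\<lambda>j. \<theta> j * c j"] L A0 by auto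
  \<comment> \<open>A lower bound for \<open>\<bar>c j\<bar>\<close>: some term
    \<open>\<theta> j * c j\<close> is at least \<open>A / (2 * L)\<close>, where \<open>A\<close>
    is at least \<open>a\<^sup>2 / g\<close> and \<open>\<bar>\<theta> j\<bar>\<close> is at most
    \<open>b\<close>.\<close>
  define q where "q = a\<^sup>2 / (2 * g * real L * b)"
  have jL: "j < L" using j S by auto
  have "\<theta> j * c j \<le> \<bar>\<theta> j\<bar> * \<bar>c j\<bar>" by (metis abs_ge_self abs_mult)
  also have "\<dots> \<le> b * \<bar>c j\<bar>" using ab(2)[of j] j by (intro mult_right_mono) auto
  finally have "\<theta> j * c j \<le> b * \<bar>c j\<bar>" .
  then have "A / 2 / real L \<le> b * \<bar>c j\<bar>" using j by linarith
  moreover have "a\<^sup>2 / (2 * g * real L) \<le> A / 2 / real L"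
    using gA g(2) L by (simp add: field_simps)
  ultimately have "a\<^sup>2 / (2 * g * real L) \<le> b * \<bar>c j\<bar>" by linarith
  then have qc: "q \<le> \<bar>c j\<bar>" unfolding q_def using b0 g(2) L by (simp add: field_simps)
  have q0: "0 < q" unfolding q_def using ab(3) b0 g(2) L by simp
  then have q2: "q\<^sup>2 \<le> (c j)\<^sup>2" using qc by (metis abs_le_square_iff abs_of_pos)
  \<comment> \<open>A step of length \<open>s\<close> along feature \<open>j\<close> gains
    \<open>2 * s * c j\<close> minus \<open>s\<^sup>2\<close> times the squared norm of the feature.
    With that norm replaced by its bound \<open>B\<close>, this choice of \<open>s\<close> is
    optimal and the gain is \<open>(c j)\<^sup>2 / B\<close>.\<close>
  define s where "s = c j / B"
  let ?w = "\<lambda>k. \<beta> k + (if k = j then s else 0)"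
  have "min_emp_risk (design_mat L n x) (vec n y) (insert j I) \<le> residual_ss L n x y ?w / real n"
    by (rule min_emp_risk_le_residual_ss[OF fr]) (use IL jL \<beta> in auto)
  moreover have "residual_ss L n x y ?w \<le> residual_ss L n x y \<beta> - q\<^sup>2 / B"
  proof -
    have "lin_fit L x ?w i = lin_fit L x \<beta> i + s * x i j" for i
      using jL by (simp add: lin_fit_def distrib_right sum.distrib if_distrib[of "\<lambda>z. z * _"] cong: if_cong)
    then have "residual_ss L n x y ?w = (\<Sum>i<n. (r i + - s * x i j)\<^sup>2)"
      by (simp add: residual_ss_def r_def algebra_simps)
    also have "\<dots> = residual_ss L n x y \<beta> - 2 * s * c j + s\<^sup>2 * (\<Sum>i<n. (x i j)\<^sup>2)"
      unfolding sum_square_add by (simp add: residual_ss_def r_def[symmetric] c_def sum_distrib_left sum_negf power_mult_distrib mult_ac)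
    also have "\<dots> \<le> residual_ss L n x y \<beta> - 2 * s * c j + s\<^sup>2 * B"
      using B(1)[OF jL] by (simp add: mult_left_mono)
    also have "\<dots> = residual_ss L n x y \<beta> - (c j)\<^sup>2 / B"
      unfolding s_def using B(2) by (simp add: field_simps power2_eq_square)
    also have "\<dots> \<le> residual_ss L n x y \<beta> - q\<^sup>2 / B" using q2 B(2) by (simp add: divide_right_mono)
    finally show ?thesis .
  qed
  ultimately have "min_emp_risk (design_mat L n x) (vec n y) (insert j I) \<le> (residual_ss L n x y \<beta> - q\<^sup>2 / B) / real n"
    by (meson divide_right_mono of_nat_0_le_iff order_trans)
  then have "q\<^sup>2 / B / real n \<le> min_emp_risk (design_mat L n x) (vec n y) I - min_emp_risk (design_mat L n x) (vec n y) (insert j I)"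
    unfolding R by (simp add: diff_divide_distrib)
  then show ?thesis using j unfolding q_def by blast
qed

section \<open>Projection onto the span of the features\<close>

text \<open>For singular \<open>A\<close> this is the zero matrix, because \<open>1 / 0 = 0\<close>; this agrees with the estimator
  chosen by \<open>theta_hat\<close> when the Gram matrix is singular.\<close>
definition inv_mat :: "real mat \<Rightarrow> real mat" where
  "inv_mat A = (1 / det A) \<cdot>\<^sub>m adj_mat A"

lemma smult_smult_mat_real: "a \<cdot>\<^sub>m (b \<cdot>\<^sub>m A) = (a * b) \<cdot>\<^sub>m (A :: real mat)"
  by (rule eq_matI) auto

lemma one_smult_mat_real: "1 \<cdot>\<^sub>m A = (A :: real mat)"
  by (rule eq_matI) auto

lemma inv_mat_carrier: "A \<in> carrier_mat n n \<Longrightarrow> inv_mat A \<in> carrier_mat n n"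
  using adj_mat(1)[of A n] by (simp add: inv_mat_def)

lemma inv_mat:
  assumes A: "A \<in> carrier_mat n n" and d: "det A \<noteq> 0"
  shows "A * inv_mat A = 1\<^sub>m n" "inv_mat A * A = 1\<^sub>m n"
proof -
  have "A * inv_mat A = (1 / det A) \<cdot>\<^sub>m (A * adj_mat A)"
    unfolding inv_mat_def by (rule mult_smult_distrib[OF A adj_mat(1)[OF A]])
  also have "\<dots> = 1\<^sub>m n" using d by (simp add: adj_mat(2)[OF A] smult_smult_mat_real one_smult_mat_real)
  finally show "A * inv_mat A = 1\<^sub>m n" .
  have "inv_mat A * A = (1 / det A) \<cdot>\<^sub>m (adj_mat A * A)"
    unfolding inv_mat_def by (rule mult_smult_assoc_mat[OF adj_mat(1)[OF A] A])
  also have "\<dots> = 1\<^sub>m n" using d by (simp add: adj_mat(3)[OF A] smult_smult_mat_real one_smult_mat_real)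
  finally show "inv_mat A * A = 1\<^sub>m n" .
qed

lemma inv_mat_unique:
  assumes A: "A \<in> carrier_mat n n" and B: "B \<in> carrier_mat n n" and AB: "A * B = 1\<^sub>m n"
  shows "inv_mat A = B"
proof -
  have "det A * det B = 1" using det_mult[OF A B] AB by simp
  then have d: "det A \<noteq> 0" by auto
  have "inv_mat A = inv_mat A * (A * B)" unfolding AB using inv_mat_carrier[OF A] by simp
  also have "\<dots> = (inv_mat A * A) * B" using assoc_mult_mat[OF inv_mat_carrier[OF A] A B] by simp
  also have "\<dots> = B" using inv_mat(2)[OF A d] B by simp
  finally show ?thesis .
qed

lemma inv_mat_singular:
  assumes A: "A \<in> carrier_mat n n" and d: "det A = 0"
  shows "inv_mat A = 0\<^sub>m n n"
  by (rule eq_matI) (use adj_mat(1)[OF A] d in \<open>auto simp: inv_mat_def\<close>)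

lemma inv_mat_smult:
  assumes A: "A \<in> carrier_mat n n" and d: "det A \<noteq> 0" and c: "c \<noteq> 0"
  shows "inv_mat (c \<cdot>\<^sub>m A) = (1 / c) \<cdot>\<^sub>m inv_mat A"
proof (rule inv_mat_unique)
  note B = inv_mat_carrier[OF A]
  have "c \<cdot>\<^sub>m A * ((1 / c) \<cdot>\<^sub>m inv_mat A) = c \<cdot>\<^sub>m ((1 / c) \<cdot>\<^sub>m (A * inv_mat A))"
    using mult_smult_distrib[OF A B] mult_smult_assoc_mat[OF A smult_carrier_mat[OF B]] by simp
  then show "c \<cdot>\<^sub>m A * ((1 / c) \<cdot>\<^sub>m inv_mat A) = 1\<^sub>m n"
    using c by (simp add: inv_mat(1)[OF A d] smult_smult_mat_real one_smult_mat_real)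
qed (use A inv_mat_carrier[OF A] in auto)

lemma inv_mat_symmetric:
  assumes A: "A \<in> carrier_mat n n" and d: "det A \<noteq> 0" and s: "A\<^sup>T = A"
  shows "(inv_mat A)\<^sup>T = inv_mat A"
proof -
  note B = inv_mat_carrier[OF A]
  have "A * (inv_mat A)\<^sup>T = (inv_mat A * A)\<^sup>T" using transpose_mult[OF B A] s by simp
  also have "\<dots> = 1\<^sub>m n" using inv_mat(2)[OF A d] by simp
  finally show ?thesis using inv_mat_unique[OF A transpose_carrier_mat[THEN iffD2, OF B]] by simp
qed

definition gram_mat :: "nat \<Rightarrow> nat \<Rightarrow> (nat \<Rightarrow> nat \<Rightarrow> real) \<Rightarrow> real mat" where
  "gram_mat L n x = design_mat L n x * (design_mat L n x)\<^sup>T"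

definition hat_mat :: "nat \<Rightarrow> nat \<Rightarrow> (nat \<Rightarrow> nat \<Rightarrow> real) \<Rightarrow> real mat" where
  "hat_mat L n x = (design_mat L n x)\<^sup>T * (inv_mat (gram_mat L n x) * design_mat L n x)"

definition mat_trace :: "real mat \<Rightarrow> real" where
  "mat_trace A = (\<Sum>j<dim_row A. A $$ (j, j))"

text \<open>The quadratic form of the projection matrix, equal to the squared norm of the projected
  noise when the Gram matrix is nonsingular. As a double sum it separates features from noise in
  each term, ready for taking expectations.\<close>

definition span_energy :: "nat \<Rightarrow> nat \<Rightarrow> (nat \<Rightarrow> nat \<Rightarrow> real) \<Rightarrow> (nat \<Rightarrow> real) \<Rightarrow> real" where
  "span_energy L n x e = (\<Sum>a<n. \<Sum>b<n. hat_mat L n x $$ (a, b) * (e a * e b))"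

context
  fixes L n :: nat and x :: "nat \<Rightarrow> nat \<Rightarrow> real"
begin

lemma design_mat_carrier: "design_mat L n x \<in> carrier_mat L n"
  by (simp add: design_mat_def)

lemma gram_mat_carrier: "gram_mat L n x \<in> carrier_mat L L"
  using design_mat_carrier by (simp add: gram_mat_def)

lemma gram_mat_index:
  "j < L \<Longrightarrow> k < L \<Longrightarrow> gram_mat L n x $$ (j, k) = (\<Sum>i<n. x i j * x i k)"
  by (simp add: gram_mat_def design_mat_def scalar_prod_def lessThan_atLeast0)

lemma gram_mat_symmetric: "(gram_mat L n x)\<^sup>T = gram_mat L n x"
  by (rule eq_matI) (use gram_mat_carrier in \<open>auto simp: gram_mat_index mult.commute\<close>)

lemma hat_mat_carrier: "hat_mat L n x \<in> carrier_mat n n"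
  unfolding hat_mat_def using design_mat_carrier inv_mat_carrier[OF gram_mat_carrier] by simp

lemma design_transpose_mult: "(design_mat L n x)\<^sup>T *\<^sub>v vec L v = vec n (lin_fit L x v)"
  by (rule eq_vecI)
    (auto simp: design_mat_def scalar_prod_def lin_fit_def lessThan_atLeast0 mult.commute intro!: sum.cong)

context
  assumes d: "det (gram_mat L n x) \<noteq> 0"
begin

private abbreviation (input) "X \<equiv> design_mat L n x"
private abbreviation (input) "B \<equiv> inv_mat (gram_mat L n x)"

private lemma Bc: "B \<in> carrier_mat L L"
  by (rule inv_mat_carrier[OF gram_mat_carrier])

private lemma BXXt: "B * X * X\<^sup>T = 1\<^sub>m L"
proof -
  have "B * X * X\<^sup>T = B * (X * X\<^sup>T)"
    by (rule assoc_mult_mat[OF Bc design_mat_carrier]) (use design_mat_carrier in auto)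
  then show ?thesis using inv_mat(2)[OF gram_mat_carrier d] unfolding gram_mat_def by simp
qed

private lemma BX: "B * X \<in> carrier_mat L n"
  using Bc design_mat_carrier by simp

private lemma Xt: "X\<^sup>T \<in> carrier_mat n L"
  using design_mat_carrier by simp

lemma hat_mat_transpose: "(hat_mat L n x)\<^sup>T = hat_mat L n x"
proof -
  have "(hat_mat L n x)\<^sup>T = (B * X)\<^sup>T * X"
    unfolding hat_mat_def using transpose_mult[OF Xt BX] by simp
  also have "(B * X)\<^sup>T = X\<^sup>T * B"
    using transpose_mult[OF Bc design_mat_carrier] inv_mat_symmetric[OF gram_mat_carrier d gram_mat_symmetric] by simp
  finally show ?thesis unfolding hat_mat_def using assoc_mult_mat[OF Xt Bc design_mat_carrier] by simp
qed

lemma hat_mat_range: "hat_mat L n x * X\<^sup>T = X\<^sup>T"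
proof -
  have "hat_mat L n x * X\<^sup>T = X\<^sup>T * (B * X * X\<^sup>T)"
    unfolding hat_mat_def by (rule assoc_mult_mat[OF Xt BX Xt])
  then show ?thesis using BXXt Xt by simp
qed

lemma hat_mat_idempotent: "hat_mat L n x * hat_mat L n x = hat_mat L n x"
proof -
  have "hat_mat L n x * (X\<^sup>T * (B * X)) = hat_mat L n x * X\<^sup>T * (B * X)"
    by (rule assoc_mult_mat[OF hat_mat_carrier Xt BX, symmetric])
  then show ?thesis unfolding hat_mat_range using hat_mat_def by metis
qed

lemma hat_mat_diag:
  assumes "a < n"
  shows "hat_mat L n x $$ (a, a) = (\<Sum>b<n. (hat_mat L n x $$ (a, b))\<^sup>2)"
proof -
  let ?P = "hat_mat L n x"
  have "?P $$ (a, a) = (?P * ?P\<^sup>T) $$ (a, a)" using hat_mat_idempotent hat_mat_transpose by simp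
  also have "\<dots> = (\<Sum>b<n. (?P $$ (a, b))\<^sup>2)"
    using hat_mat_carrier assms by (auto simp: scalar_prod_def lessThan_atLeast0 power2_eq_square)
  finally show ?thesis .
qed

text \<open>A symmetric idempotent matrix has each diagonal entry equal to the squared norm of its
  row. Hence \<open>p\<^sup>2 \<le> p\<close> for a diagonal entry \<open>p\<close>, so
  \<open>p \<le> 1\<close>, and \<open>p\<close> bounds the squares of all entries in its
  row.\<close>

lemma hat_mat_bounded_nonsingular:
  assumes "a < n" "b < n"
  shows "\<bar>hat_mat L n x $$ (a, b)\<bar> \<le> 1"
proof -
  let ?P = "hat_mat L n x"
  have le: "(?P $$ (a, c))\<^sup>2 \<le> ?P $$ (a, a)" if "c < n" for c
    unfolding hat_mat_diag[OF assms(1)] using that by (intro member_le_sum) auto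
  have "?P $$ (a, a) \<le> 1"
  proof (rule ccontr)
    assume "\<not> ?thesis"
    then have "1 * ?P $$ (a, a) < ?P $$ (a, a) * ?P $$ (a, a)" by (intro mult_strict_right_mono) auto
    then show False using le[OF assms(1)] by (simp add: power2_eq_square)
  qed
  then have "(?P $$ (a, b))\<^sup>2 \<le> 1" using le[OF assms(2)] by linarith
  then show ?thesis by (simp add: abs_square_le_1)
qed

text \<open>Cyclicity of the trace moves \<open>X\<^sup>T\<close> to the right end, where the
  product collapses to the identity of size \<open>L\<close>.\<close>

lemma hat_mat_trace_nonsingular: "(\<Sum>a<n. hat_mat L n x $$ (a, a)) = real L"
proof -
  have "(\<Sum>a<n. hat_mat L n x $$ (a, a)) = (\<Sum>a<n. \<Sum>j<L. X $$ (j, a) * (B * X) $$ (j, a))"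
    unfolding hat_mat_def using Xt BX by (intro sum.cong refl) (auto simp: scalar_prod_def lessThan_atLeast0)
  also have "\<dots> = (\<Sum>j<L. \<Sum>a<n. (B * X) $$ (j, a) * X $$ (j, a))"
    by (subst sum.swap) (simp add: mult.commute)
  also have "\<dots> = (\<Sum>j<L. (B * X * X\<^sup>T) $$ (j, j))"
    using BX design_mat_carrier by (intro sum.cong refl) (auto simp: scalar_prod_def lessThan_atLeast0)
  also have "\<dots> = real L" unfolding BXXt by simp
  finally show ?thesis .
qed

lemma span_energy_eq: 
  "span_energy L n x e = (hat_mat L n x *\<^sub>v vec n e) \<bullet> (hat_mat L n x *\<^sub>v vec n e)"
proof -
  let ?P = "hat_mat L n x" and ?e = "vec n e"
  have Pe: "?P *\<^sub>v ?e \<in> carrier_vec n" using hat_mat_carrier by simp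
  have "span_energy L n x e = ?e \<bullet> (?P *\<^sub>v ?e)"
    unfolding span_energy_def using hat_mat_carrier
    by (auto simp: scalar_prod_def lessThan_atLeast0 sum_distrib_left mult_ac intro!: sum.cong)
  also have "?P *\<^sub>v ?e = ?P *\<^sub>v (?P *\<^sub>v ?e)"
    using hat_mat_idempotent hat_mat_carrier by (metis assoc_mult_mat_vec vec_carrier)
  also have "?e \<bullet> (?P *\<^sub>v (?P *\<^sub>v ?e)) = (?P\<^sup>T *\<^sub>v ?e) \<bullet> (?P *\<^sub>v ?e)"
    using transpose_vec_mult_scalar[OF hat_mat_carrier Pe vec_carrier] by simp
  finally show ?thesis by (simp add: hat_mat_transpose)
qed

lemma span_energy_nonneg: "0 \<le> span_energy L n x e"
  unfolding span_energy_eq by (simp add: scalar_prod_def sum_nonneg)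

text \<open>The projection fixes fitted vectors and is symmetric, so \<open>e\<close> may be
  replaced by its projection before applying the Cauchy-Schwarz inequality.\<close>

lemma span_energy_bound:
  "(\<Sum>i<n. lin_fit L x v i * e i)\<^sup>2 \<le> span_energy L n x e * (\<Sum>i<n. (lin_fit L x v i)\<^sup>2)"
proof -
  let ?P = "hat_mat L n x" and ?e = "vec n e" and ?u = "vec n (lin_fit L x v)"
  have Pe: "?P *\<^sub>v ?e \<in> carrier_vec n" using hat_mat_carrier by simp
  have "?P *\<^sub>v ?u = ?u"
    using hat_mat_range hat_mat_carrier Xt unfolding design_transpose_mult[symmetric]
    by (metis assoc_mult_mat_vec vec_carrier)
  then have "?u \<bullet> ?e = (?P\<^sup>T *\<^sub>v ?u) \<bullet> ?e" by (simp add: hat_mat_transpose)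
  also have "\<dots> = ?u \<bullet> (?P *\<^sub>v ?e)"
    using transpose_vec_mult_scalar[OF hat_mat_carrier vec_carrier[of n e] vec_carrier] by simp
  finally have ue: "?u \<bullet> ?e = ?u \<bullet> (?P *\<^sub>v ?e)" .
  define q where "q i = (?P *\<^sub>v ?e) $ i" for i
  have "(\<Sum>i<n. lin_fit L x v i * e i) = (\<Sum>i<n. lin_fit L x v i * q i)"
    using ue Pe hat_mat_carrier unfolding scalar_prod_def by (simp add: lessThan_atLeast0 q_def del: index_mult_mat_vec)
  moreover have "(\<Sum>i<n. (q i)\<^sup>2) = span_energy L n x e"
    unfolding span_energy_eq q_def scalar_prod_def using Pe hat_mat_carrier by (simp add: lessThan_atLeast0 power2_eq_square del: index_mult_mat_vec)
  ultimately show ?thesis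
    using Cauchy_Schwarz_ineq_sum[of "lin_fit L x v" q "{..<n}"] by (simp add: mult.commute)
qed

text \<open>The trace of the inverse Gram matrix stands in for the reciprocal of the smallest
  eigenvalue. The coefficients are \<open>B * X\<close> applied to the fitted vector, and row
  \<open>j\<close> of \<open>B * X\<close> has squared norm \<open>B $$ (j, j)\<close>, so
  Cauchy-Schwarz applies.\<close>

lemma coeff_bound:
  assumes j: "j < L"
  shows "(v j)\<^sup>2 \<le> mat_trace B * (\<Sum>i<n. (lin_fit L x v i)\<^sup>2)"
proof -
  define c where "c k i = (B * X) $$ (k, i)" for k i
  have cc: "(\<Sum>i<n. (c k i)\<^sup>2) = B $$ (k, k)" if k: "k < L" for k
  proof -
    have "(\<Sum>i<n. (c k i)\<^sup>2) = ((B * X) * (B * X)\<^sup>T) $$ (k, k)"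
      proof -
      have "((B * X) * (B * X)\<^sup>T) $$ (k, k) = row (B * X) k \<bullet> row (B * X) k" using Bc design_mat_carrier k by auto
      also have "\<dots> = (\<Sum>i<n. (B * X) $$ (k, i) * (B * X) $$ (k, i))"
        using Bc design_mat_carrier k unfolding scalar_prod_def by (auto simp: lessThan_atLeast0)
      finally show ?thesis unfolding c_def by (simp add: power2_eq_square)
    qed
    also have "(B * X) * (B * X)\<^sup>T = B * X * (X\<^sup>T * B)"
      using transpose_mult[OF Bc design_mat_carrier] inv_mat_symmetric[OF gram_mat_carrier d gram_mat_symmetric] by simp
    also have "\<dots> = B * X * X\<^sup>T * B" using assoc_mult_mat[OF BX Xt Bc] by simp
    also have "\<dots> = B" using BXXt Bc by simp
    finally show ?thesis .
  qed
  let ?A = "\<Sum>i<n. (lin_fit L x v i)\<^sup>2"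
  have "vec L v = (B * X * X\<^sup>T) *\<^sub>v vec L v" unfolding BXXt by simp
  also have "\<dots> = (B * X) *\<^sub>v (X\<^sup>T *\<^sub>v vec L v)" by (rule assoc_mult_mat_vec[OF BX Xt]) simp
  finally have "vec L v $ j = ((B * X) *\<^sub>v vec n (lin_fit L x v)) $ j" unfolding design_transpose_mult by simp
  also have "\<dots> = row (B * X) j \<bullet> vec n (lin_fit L x v)" using j Bc by simp
  also have "\<dots> = (\<Sum>i<n. c j i * lin_fit L x v i)"
    using j Bc design_mat_carrier unfolding c_def scalar_prod_def by (auto simp: lessThan_atLeast0)
  finally have "v j = (\<Sum>i<n. c j i * lin_fit L x v i)" using j by simp
  then have "(v j)\<^sup>2 \<le> B $$ (j, j) * ?A"
    using Cauchy_Schwarz_ineq_sum[of "c j" "lin_fit L x v" "{..<n}"] cc[OF j] by simp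
  also have "\<dots> \<le> mat_trace B * ?A"
  proof (intro mult_right_mono)
    have "0 \<le> B $$ (k, k)" if "k < L" for k using cc[OF that] by (metis sum_nonneg zero_le_power2)
    then show "B $$ (j, j) \<le> mat_trace B"
      unfolding mat_trace_def using j Bc by (intro member_le_sum) auto
  qed (simp add: sum_nonneg)
  finally show ?thesis .
qed

end

lemma hat_mat_singular:
  assumes "det (gram_mat L n x) = 0"
  shows "hat_mat L n x = 0\<^sub>m n n"
  unfolding hat_mat_def inv_mat_singular[OF gram_mat_carrier assms]
  using design_mat_carrier by simp

text \<open>Valid for every outcome and sample size, including \<open>n < L\<close>, where the Gram
  matrix is singular; this is what integrability of the entries rests on.\<close>

lemma hat_mat_bounded:
  assumes "a < n" "b < n"
  shows "\<bar>hat_mat L n x $$ (a, b)\<bar> \<le> 1"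
  using hat_mat_bounded_nonsingular[OF _ assms] hat_mat_singular assms
  by (cases "det (gram_mat L n x) = 0") auto

lemma hat_mat_trace: "(\<Sum>a<n. hat_mat L n x $$ (a, a)) \<le> real L"
  using hat_mat_trace_nonsingular hat_mat_singular
  by (cases "det (gram_mat L n x) = 0") auto

end

lemma full_row_rank_det_gram: "full_row_rank L n x \<Longrightarrow> det (gram_mat L n x) \<noteq> 0"
  using det_gram_nonzero[of L n x "{..<L}"] by (simp add: feature_rows_all gram_mat_def)

section \<open>Measurability of the procedure\<close>

definition measurable_mat :: "'a measure \<Rightarrow> nat \<Rightarrow> nat \<Rightarrow> ('a \<Rightarrow> real mat) \<Rightarrow> bool" where
  "measurable_mat N r c A \<longleftrightarrow> (\<forall>\<omega>. A \<omega> \<in> carrier_mat r c) \<and>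
     (\<forall>i<r. \<forall>j<c. (\<lambda>\<omega>. A \<omega> $$ (i, j)) \<in> borel_measurable N)"

definition measurable_vec :: "'a measure \<Rightarrow> nat \<Rightarrow> ('a \<Rightarrow> real vec) \<Rightarrow> bool" where
  "measurable_vec N r v \<longleftrightarrow> (\<forall>\<omega>. v \<omega> \<in> carrier_vec r) \<and>
     (\<forall>i<r. (\<lambda>\<omega>. v \<omega> $ i) \<in> borel_measurable N)"

lemma measurable_matD:
  assumes "measurable_mat N r c A"
  shows "A \<omega> \<in> carrier_mat r c" "dim_row (A \<omega>) = r" "dim_col (A \<omega>) = c"
    "i < r \<Longrightarrow> j < c \<Longrightarrow> (\<lambda>\<omega>. A \<omega> $$ (i, j)) \<in> borel_measurable N"
  using assms by (auto simp: measurable_mat_def)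

lemma measurable_vecD:
  assumes "measurable_vec N r v"
  shows "v \<omega> \<in> carrier_vec r" "dim_vec (v \<omega>) = r"
    "i < r \<Longrightarrow> (\<lambda>\<omega>. v \<omega> $ i) \<in> borel_measurable N"
  using assms by (auto simp: measurable_vec_def)

lemma measurable_mat_transpose:
  assumes A: "measurable_mat N r c A"
  shows "measurable_mat N c r (\<lambda>\<omega>. (A \<omega>)\<^sup>T)"
  unfolding measurable_mat_def
proof (intro conjI allI impI)
  show "(A \<omega>)\<^sup>T \<in> carrier_mat c r" for \<omega>
    using measurable_matD(1)[OF A] by simp
  fix i j assume ij: "i < c" "j < r"
  have eq: "(A \<omega>)\<^sup>T $$ (i, j) = A \<omega> $$ (j, i)" for \<omega>
    using ij measurable_matD(2,3)[OF A] by simp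
  show "(\<lambda>\<omega>. (A \<omega>)\<^sup>T $$ (i, j)) \<in> borel_measurable N"
    unfolding eq by (rule measurable_matD(4)[OF A ij(2,1)])
qed

lemma measurable_mat_mult:
  assumes A: "measurable_mat N r m A" and B: "measurable_mat N m c B"
  shows "measurable_mat N r c (\<lambda>\<omega>. A \<omega> * B \<omega>)"
  unfolding measurable_mat_def
proof (intro conjI allI impI)
  show "A \<omega> * B \<omega> \<in> carrier_mat r c" for \<omega>
    using measurable_matD(1)[OF A] measurable_matD(1)[OF B] by (rule mult_carrier_mat)
  fix i j assume ij: "i < r" "j < c"
  have eq: "(A \<omega> * B \<omega>) $$ (i, j) = (\<Sum>k=0..<m. A \<omega> $$ (i, k) * B \<omega> $$ (k, j))" for \<omega>
    using ij measurable_matD(2,3)[OF A] measurable_matD(2,3)[OF B] by (simp add: scalar_prod_def)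
  show "(\<lambda>\<omega>. (A \<omega> * B \<omega>) $$ (i, j)) \<in> borel_measurable N"
    unfolding eq
    by (rule borel_measurable_sum, rule borel_measurable_times[OF measurable_matD(4)[OF A] measurable_matD(4)[OF B]])
      (use ij in auto)
qed

lemma measurable_mat_mult_vec:
  assumes A: "measurable_mat N r m A" and v: "measurable_vec N m v"
  shows "measurable_vec N r (\<lambda>\<omega>. A \<omega> *\<^sub>v v \<omega>)"
  unfolding measurable_vec_def
proof (intro conjI allI impI)
  show "A \<omega> *\<^sub>v v \<omega> \<in> carrier_vec r" for \<omega>
    using measurable_matD(1)[OF A] measurable_vecD(1)[OF v] by (rule mult_mat_vec_carrier)
  fix i assume i: "i < r"
  have eq: "(A \<omega> *\<^sub>v v \<omega>) $ i = (\<Sum>k=0..<m. A \<omega> $$ (i, k) * v \<omega> $ k)" for \<omega>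
    using i measurable_matD(2,3)[OF A] measurable_vecD(2)[OF v] by (simp add: scalar_prod_def)
  show "(\<lambda>\<omega>. (A \<omega> *\<^sub>v v \<omega>) $ i) \<in> borel_measurable N"
    unfolding eq
    by (rule borel_measurable_sum, rule borel_measurable_times[OF measurable_matD(4)[OF A] measurable_vecD(3)[OF v]])
      (use i in auto)
qed

lemma borel_measurable_det:
  assumes A: "measurable_mat N n n A"
  shows "(\<lambda>\<omega>. det (A \<omega>)) \<in> borel_measurable N"
  unfolding det_def'[OF measurable_matD(1)[OF A]]
  by (rule borel_measurable_sum, rule borel_measurable_times[OF borel_measurable_const borel_measurable_prod],
      rule measurable_matD(4)[OF A]) (auto simp: permutes_in_image)

lemma measurable_mat_delete:
  assumes A: "measurable_mat N n n A"
  shows "measurable_mat N (n - 1) (n - 1) (\<lambda>\<omega>. mat_delete (A \<omega>) k l)"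
  unfolding measurable_mat_def
proof (intro conjI allI impI)
  show "mat_delete (A \<omega>) k l \<in> carrier_mat (n - 1) (n - 1)" for \<omega>
    by (simp add: mat_delete_def measurable_matD(2,3)[OF A])
  fix i j assume ij: "i < n - 1" "j < n - 1"
  have eq: "mat_delete (A \<omega>) k l $$ (i, j) =
      A \<omega> $$ (if i < k then i else Suc i, if j < l then j else Suc j)" for \<omega>
    using ij by (simp add: mat_delete_def measurable_matD(2,3)[OF A])
  show "(\<lambda>\<omega>. mat_delete (A \<omega>) k l $$ (i, j)) \<in> borel_measurable N"
    unfolding eq by (rule measurable_matD(4)[OF A]) (use ij in auto)
qed

text \<open>Cramer's rule makes each entry a quotient of polynomials in the entries of
  \<open>A\<close>; with the convention \<open>1 / 0 = 0\<close> the quotient is measurable on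
  singular matrices as well.\<close>

lemma measurable_inv_mat:
  assumes A: "measurable_mat N n n A"
  shows "measurable_mat N n n (\<lambda>\<omega>. inv_mat (A \<omega>))"
  unfolding measurable_mat_def
proof (intro conjI allI impI)
  show "inv_mat (A \<omega>) \<in> carrier_mat n n" for \<omega>
    using measurable_matD(1)[OF A] by (rule inv_mat_carrier)
  fix i j assume ij: "i < n" "j < n"
  have eq: "inv_mat (A \<omega>) $$ (i, j) = 1 / det (A \<omega>) * ((-1) ^ (j + i) * det (mat_delete (A \<omega>) j i))" for \<omega>
    using ij measurable_matD(2,3)[OF A] by (simp add: inv_mat_def adj_mat_def cofactor_def)
  show "(\<lambda>\<omega>. inv_mat (A \<omega>) $$ (i, j)) \<in> borel_measurable N"
    unfolding eq
    by (rule borel_measurable_times[OF borel_measurable_divide[OF borel_measurable_const borel_measurable_det[OF A]]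
          borel_measurable_times[OF borel_measurable_const borel_measurable_det[OF measurable_mat_delete[OF A]]]])
qed

lemma tendsto_det:
  assumes A: "\<And>n. A n \<in> carrier_mat r r" "M \<in> carrier_mat r r"
    and lim: "\<And>i j. i < r \<Longrightarrow> j < r \<Longrightarrow> (\<lambda>n. A n $$ (i, j)) \<longlonglongrightarrow> M $$ (i, j)"
  shows "(\<lambda>n. det (A n)) \<longlonglongrightarrow> det (M :: real mat)"
  unfolding det_def'[OF A(1)] det_def'[OF A(2)]
  by (rule tendsto_sum, rule tendsto_mult[OF tendsto_const tendsto_prod], rule lim) (auto simp: permutes_in_image)

lemma tendsto_inv_mat:
  assumes A: "\<And>n. A n \<in> carrier_mat r r" "M \<in> carrier_mat r r"
    and lim: "\<And>i j. i < r \<Longrightarrow> j < r \<Longrightarrow> (\<lambda>n. A n $$ (i, j)) \<longlonglongrightarrow> M $$ (i, j)"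
    and d: "det M \<noteq> 0" and ij: "i < r" "j < r"
  shows "(\<lambda>n. inv_mat (A n) $$ (i, j)) \<longlonglongrightarrow> inv_mat M $$ (i, j)"
proof -
  have eq: "inv_mat B $$ (i, j) = 1 / det B * ((-1) ^ (j + i) * det (mat_delete B j i))"
    if "B \<in> carrier_mat r r" for B
    using ij that by (auto simp: inv_mat_def adj_mat_def cofactor_def)
  have del: "(\<lambda>n. det (mat_delete (A n) j i)) \<longlonglongrightarrow> det (mat_delete M j i)"
  proof (rule tendsto_det[where r = "r - 1"])
    show "mat_delete (A n) j i \<in> carrier_mat (r - 1) (r - 1)" for n
      using A(1)[of n] by (auto simp: mat_delete_def)
    show "mat_delete M j i \<in> carrier_mat (r - 1) (r - 1)"
      using A(2) by (auto simp: mat_delete_def)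
    fix i' j' assume "i' < r - 1" "j' < r - 1"
    then show "(\<lambda>n. mat_delete (A n) j i $$ (i', j')) \<longlonglongrightarrow> mat_delete M j i $$ (i', j')"
      using A by (simp add: mat_delete_def carrier_matD[OF A(1)] carrier_matD[OF A(2)])
        (intro conjI impI lim; simp)
  qed
  show ?thesis unfolding eq[OF A(1)] eq[OF A(2)]
    by (rule tendsto_mult[OF tendsto_divide[OF tendsto_const tendsto_det[OF A lim] d]
          tendsto_mult[OF tendsto_const del]]) assumption+
qed

text \<open>Exchanges the case distinction on \<open>mat_inverse\<close> for one formula whose
  measurability is known; both sides are the zero vector when the Gram matrix is singular.\<close>

lemma theta_hat_eq:
  assumes X: "X \<in> carrier_mat L n" and y: "y \<in> carrier_vec n"
  shows "theta_hat X y I =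
    inv_mat (feature_rows X I * (feature_rows X I)\<^sup>T) *\<^sub>v (feature_rows X I *\<^sub>v y)"
proof -
  define Z where "Z = feature_rows X I"
  define m where "m = dim_row Z"
  have Z: "Z \<in> carrier_mat m n" using X by (simp add: Z_def m_def feature_rows_def submatrix_def)
  have G: "Z * Z\<^sup>T \<in> carrier_mat m m" using Z by simp
  have Zy: "Z *\<^sub>v y \<in> carrier_vec m" using Z y by simp
  show ?thesis
  proof (cases "mat_inverse (Z * Z\<^sup>T)")
    case None
    have "det (Z * Z\<^sup>T) = 0"
      using mat_inverse(1)[OF G None, where b = "()"] det_non_zero_imp_unit[OF G, where b = "()"] by blast
    then have "inv_mat (Z * Z\<^sup>T) = 0\<^sub>m m m" by (rule inv_mat_singular[OF G])
    moreover have "0\<^sub>m m m *\<^sub>v (Z *\<^sub>v y) = 0\<^sub>v m" using Zy by (auto intro!: eq_vecI)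
    ultimately show ?thesis unfolding theta_hat_def Let_def Z_def[symmetric] None m_def by simp
  next
    case (Some B)
    then have "inv_mat (Z * Z\<^sup>T) = B"
      using mat_inverse(2)[OF G Some] inv_mat_unique[OF G] by blast
    then show ?thesis unfolding theta_hat_def Let_def Z_def[symmetric] Some by simp
  qed
qed

lemma measurable_mat_feature_rows:
  assumes X: "measurable_mat N L n X"
  shows "measurable_mat N (card {i. i < L \<and> i \<in> I}) n (\<lambda>\<omega>. feature_rows (X \<omega>) I)"
  unfolding measurable_mat_def
proof (intro conjI allI impI)
  show "feature_rows (X \<omega>) I \<in> carrier_mat (card {i. i < L \<and> i \<in> I}) n" for \<omega>
    by (simp add: feature_rows_def submatrix_def measurable_matD(2,3)[OF X])
  fix a i assume ai: "a < card {i. i < L \<and> i \<in> I}" "i < n"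
  have eq: "feature_rows (X \<omega>) I $$ (a, i) = X \<omega> $$ (pick I a, i)" for \<omega>
    using ai by (simp add: feature_rows_def submatrix_def measurable_matD(2,3)[OF X] pick_UNIV)
  show "(\<lambda>\<omega>. feature_rows (X \<omega>) I $$ (a, i)) \<in> borel_measurable N"
    unfolding eq by (rule measurable_matD(4)[OF X pick_le[OF ai(1)] ai(2)])
qed

lemma borel_measurable_min_emp_risk:
  assumes X: "measurable_mat N L n X" and y: "measurable_vec N n y"
  shows "(\<lambda>\<omega>. min_emp_risk (X \<omega>) (y \<omega>) I) \<in> borel_measurable N"
proof -
  let ?Z = "\<lambda>\<omega>. feature_rows (X \<omega>) I"
  note Z = measurable_mat_feature_rows[OF X, of I]
  note Zt = measurable_mat_transpose[OF Z]
  have p: "measurable_vec N n (\<lambda>\<omega>. (?Z \<omega>)\<^sup>T *\<^sub>v theta_hat (X \<omega>) (y \<omega>) I)"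
    unfolding theta_hat_eq[OF measurable_matD(1)[OF X] measurable_vecD(1)[OF y]]
    by (intro measurable_mat_mult_vec[OF Zt] measurable_mat_mult_vec[OF measurable_inv_mat]
        measurable_mat_mult[OF Z Zt] measurable_mat_mult_vec[OF Z y])
  have eq: "min_emp_risk (X \<omega>) (y \<omega>) I =
      (\<Sum>i=0..<n. (y \<omega> $ i - ((?Z \<omega>)\<^sup>T *\<^sub>v theta_hat (X \<omega>) (y \<omega>) I) $ i) *
                  (y \<omega> $ i - ((?Z \<omega>)\<^sup>T *\<^sub>v theta_hat (X \<omega>) (y \<omega>) I) $ i)) / real n" for \<omega>
    unfolding min_emp_risk_def emp_risk_def Let_def scalar_prod_def
    using measurable_vecD(1,2)[OF p, of \<omega>] measurable_vecD(2)[OF y, of \<omega>]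
    by (simp del: index_mult_mat_vec)
  show ?thesis unfolding eq
    by (intro borel_measurable_divide borel_measurable_sum borel_measurable_times
       borel_measurable_diff borel_measurable_const measurable_vecD(3)[OF p] measurable_vecD(3)[OF y]) auto
qed

text \<open>Ties are broken by the choice operator, about which nothing is known except that it
  depends on the set of minimizers alone. That set is a measurable function with finitely many
  values, and any function of it is measurable.\<close>

lemma measurable_arg_min_on:
  fixes f :: "nat \<Rightarrow> 'a \<Rightarrow> real"
  assumes f: "\<And>j. j \<in> D \<Longrightarrow> f j \<in> borel_measurable N" and D: "finite D"
  shows "(\<lambda>\<omega>. arg_min_on (\<lambda>j. f j \<omega>) D) \<in> measurable N (count_space UNIV)"
proof -
  have sel: "(\<lambda>\<omega>. arg_min_on (\<lambda>j. f j \<omega>) D) =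
      (\<lambda>A. SOME j. j \<in> A) \<circ> (\<lambda>\<omega>. {j\<in>D. \<forall>i\<in>D. f j \<omega> \<le> f i \<omega>})"
    by (auto simp: fun_eq_iff arg_min_on_def arg_min_def is_arg_min_def not_less
        intro!: arg_cong[where f = Eps])
  have "(\<lambda>\<omega>. {j\<in>D. \<forall>i\<in>D. f j \<omega> \<le> f i \<omega>}) \<in> measurable N (count_space (Pow D))"
  proof (rule measurableI)
    fix \<omega> assume "\<omega> \<in> space N" 
    show "{j\<in>D. \<forall>i\<in>D. f j \<omega> \<le> f i \<omega>} \<in> space (count_space (Pow D))" by auto
  next
    fix A assume "A \<in> sets (count_space (Pow D))"
    then have A: "A \<subseteq> Pow D" by simp
    then have fin: "finite A" using D by (simp add: finite_subset)
    have "(\<lambda>\<omega>. {j\<in>D. \<forall>i\<in>D. f j \<omega> \<le> f i \<omega>}) -` A \<inter> space N =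
      (\<Union>C\<in>A. {\<omega>\<in>space N. {j\<in>D. \<forall>i\<in>D. f j \<omega> \<le> f i \<omega>} = C})"
      by auto
    also have "\<dots> \<in> sets N"
    proof (rule sets.finite_UN[OF fin])
      fix C assume "C \<in> A"
      then have "C \<subseteq> D" using A by auto
      then have eq: "({j\<in>D. \<forall>i\<in>D. f j \<omega> \<le> f i \<omega>} = C) = (\<forall>j\<in>D. (j \<in> C) = (\<forall>i\<in>D. f j \<omega> \<le> f i \<omega>))" for \<omega>
        by blast
      note f[measurable]
      have "Measurable.pred N (\<lambda>\<omega>. \<forall>j\<in>D. (j \<in> C) = (\<forall>i\<in>D. f j \<omega> \<le> f i \<omega>))"
        using D f by (intro pred_intros_finite) measurable
      then show "{\<omega>\<in>space N. {j\<in>D. \<forall>i\<in>D. f j \<omega> \<le> f i \<omega>} = C} \<in> sets N"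
        unfolding eq by (simp only: pred_def)
    qed
    finally show "(\<lambda>\<omega>. {j\<in>D. \<forall>i\<in>D. f j \<omega> \<le> f i \<omega>}) -` A \<inter> space N \<in> sets N" .
  qed
  then show ?thesis unfolding sel by (rule measurable_comp) simp
qed

text \<open>The previous index set has only countably many possible values, so it can be treated as
  fixed in the next step.\<close>

lemma measurable_sner_set:
  assumes X: "measurable_mat N L n X" and y: "measurable_vec N n y"
  shows "(\<lambda>\<omega>. sner_set (X \<omega>) (y \<omega>) k) \<in> measurable N (count_space {A. finite A})"
proof (induction k)
  case 0
  then show ?case by simp
next
  case (Suc k)
  have "(\<lambda>\<omega>. (\<lambda>I \<omega>. insert (arg_min_on (\<lambda>j. min_emp_risk (X \<omega>) (y \<omega>) (insert j I)) ({..<L} - I)) I)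
      (sner_set (X \<omega>) (y \<omega>) k) \<omega>) \<in> measurable N (count_space {A. finite A})"
  proof (rule measurable_compose_countable'[OF _ Suc countable_Collect_finite])
    fix I :: "nat set" assume I: "I \<in> {A. finite A}"
    have "(\<lambda>\<omega>. arg_min_on (\<lambda>j. min_emp_risk (X \<omega>) (y \<omega>) (insert j I)) ({..<L} - I)) \<in> measurable N (count_space UNIV)"
      by (intro measurable_arg_min_on borel_measurable_min_emp_risk[OF X y]) simp
    moreover have "(\<lambda>j. insert j I) \<in> measurable (count_space UNIV) (count_space {A. finite A})"
      using I by simp
    ultimately show "(\<lambda>\<omega>. insert (arg_min_on (\<lambda>j. min_emp_risk (X \<omega>) (y \<omega>) (insert j I)) ({..<L} - I)) I)
        \<in> measurable N (count_space {A. finite A})"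
      by (rule measurable_compose)
  qed
  then show ?case by (simp add: measurable_matD(2)[OF X])
qed

lemma borel_measurable_min_emp_risk_sner_set:
  assumes X: "measurable_mat N L n X" and y: "measurable_vec N n y"
  shows "(\<lambda>\<omega>. min_emp_risk (X \<omega>) (y \<omega>) (sner_set (X \<omega>) (y \<omega>) k)) \<in> borel_measurable N"
  by (rule measurable_compose_countable'[OF _ measurable_sner_set[OF X y] countable_Collect_finite,
        where f = "\<lambda>I \<omega>. min_emp_risk (X \<omega>) (y \<omega>) I"])
    (rule borel_measurable_min_emp_risk[OF X y])

lemma measurable_sner_Lbar:
  assumes X: "measurable_mat N L n X" and y: "measurable_vec N n y"
  shows "(\<lambda>\<omega>. sner_Lbar (X \<omega>) (y \<omega>) \<tau>) \<in> measurable N (count_space UNIV)"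
proof -
  note [measurable] = borel_measurable_min_emp_risk_sner_set[OF X y]
  have "(\<lambda>\<omega>. sner_Khat (X \<omega>) (y \<omega>) \<tau>) \<in> measurable N (count_space UNIV)"
    unfolding sner_Khat_def risk_decrease_def measurable_matD(2)[OF X] by measurable
  then have "(\<lambda>\<omega>. min (sner_Khat (X \<omega>) (y \<omega>) \<tau> + 1) L) \<in> measurable N (count_space UNIV)"
    by (rule measurable_compose) simp
  then show ?thesis unfolding sner_Lbar_def measurable_matD(2)[OF X] .
qed

section \<open>Quantiles of the chi-square law\<close>

lemma measure_normal_density_interval_pos:
  assumes "0 < \<sigma>" "a < b"
  shows "0 < measure (density lborel (normal_density \<mu> \<sigma>)) {a<..<b}"
proof -
  let ?N = "density lborel (\<lambda>x. ennreal (normal_density \<mu> \<sigma> x))"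
  interpret prob_space ?N by (rule prob_space_normal_density[OF assms(1)])
  have "emeasure ?N {a<..<b} \<noteq> 0"
  proof
    assume "emeasure ?N {a<..<b} = 0"
    then have "AE x in ?N. x \<notin> {a<..<b}" by (intro AE_I[of _ _ "{a<..<b}"]) auto
    then have "AE x in lborel. x \<notin> {a<..<b}"
      using normal_density_pos[OF assms(1)] by (simp add: AE_density)
    then have "emeasure lborel {a<..<b} = 0"
      by (subst (asm) AE_iff_measurable[where N = "{a<..<b}"]) auto
    then show False using assms(2) by simp
  qed
  then show ?thesis by (simp add: emeasure_eq_measure less_le)
qed

lemma cdf_chi_square_1: "cdf chi_square_1 t = measure std_normal_distribution {z. z\<^sup>2 \<le> t}"
  unfolding cdf_def chi_square_1_def by (subst measure_distr) (auto intro!: arg_cong[where f = "measure _"])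

lemma cdf_chi_square_1_mono:
  assumes "s \<le> t"
  shows "cdf chi_square_1 s \<le> cdf chi_square_1 t"
proof -
  interpret real_distribution std_normal_distribution by (rule real_dist_normal_dist)
  show ?thesis unfolding cdf_chi_square_1 using assms
    by (intro finite_measure_mono) auto
qed

lemma cdf_chi_square_1_compl:
  "cdf chi_square_1 t = 1 - measure std_normal_distribution {z. t < z\<^sup>2}"
proof -
  interpret real_distribution std_normal_distribution by (rule real_dist_normal_dist)
  have "{z::real. z\<^sup>2 \<le> t} = space std_normal_distribution - {z. t < z\<^sup>2}" by auto
  then show ?thesis unfolding cdf_chi_square_1 using prob_compl[of "{z. t < z\<^sup>2}"] by simp
qed

text \<open>The normal law charges the interval from \<open>t + 1\<close> to \<open>t + 2\<close>,
  on which squares exceed \<open>t\<close>.\<close>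

lemma cdf_chi_square_1_less_1:
  assumes "0 \<le> t"
  shows "cdf chi_square_1 t < 1"
proof -
  interpret real_distribution std_normal_distribution by (rule real_dist_normal_dist)
  have "z\<^sup>2 > t" if "t + 1 < z" for z :: real
  proof -
    have "t + 1 \<le> (t + 1)\<^sup>2" using assms by (simp add: power2_eq_square)
    also have "\<dots> \<le> z\<^sup>2" using that assms by (intro power_mono) auto
    finally show ?thesis by simp
  qed
  then have "measure std_normal_distribution {t+1<..<t+2} \<le> measure std_normal_distribution {z. t < z\<^sup>2}"
    by (intro finite_measure_mono) auto
  then show ?thesis
    unfolding cdf_chi_square_1_compl using measure_normal_density_interval_pos[of 1 "t+1" "t+2" 0] by simp
qed

text \<open>The fourth moment is needed: Markov's inequality for the second moment would not beat the
  rate \<open>\<delta> = c/n\<close>.\<close>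
lemma cdf_chi_square_1_ge:
  assumes t: "0 < t"
  shows "1 - 3 / t\<^sup>2 \<le> cdf chi_square_1 t"
proof -
  interpret real_distribution std_normal_distribution by (rule real_dist_normal_dist)
  have i: "integrable std_normal_distribution (\<lambda>z. z ^ 4)"
    using std_normal_distribution_even_moments[of 2] by simp
  have e: "(\<integral>z. z ^ 4 \<partial>std_normal_distribution) = 3"
    using std_normal_distribution_even_moments[of 2] by (simp add: fact_numeral)
  have "measure std_normal_distribution {z. t < z\<^sup>2} \<le> measure std_normal_distribution {z\<in>space std_normal_distribution. t\<^sup>2 \<le> z ^ 4}"
  proof (intro finite_measure_mono subsetI)
    fix z :: real assume "z \<in> {z. t < z\<^sup>2}"
    then have "t\<^sup>2 \<le> (z\<^sup>2)\<^sup>2" using t by (intro power_mono) auto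
    then show "z \<in> {z\<in>space std_normal_distribution. t\<^sup>2 \<le> z ^ 4}" by simp
  qed simp
  also have "\<dots> \<le> (\<integral>z. z ^ 4 \<partial>std_normal_distribution) / t\<^sup>2"
    using integral_Markov_inequality_measure[OF i, of "{}" "t\<^sup>2"] t by simp
  finally show ?thesis unfolding cdf_chi_square_1_compl e by simp
qed

lemma chi_square_1_inv_le:
  assumes "0 < t" "3 / t\<^sup>2 \<le> \<delta>"
  shows "chi_square_1_inv (1 - \<delta>) \<le> t"
  unfolding chi_square_1_inv_def
proof (rule cInf_lower)
  show "t \<in> {t. 0 \<le> t \<and> 1 - \<delta> \<le> cdf chi_square_1 t}"
    using assms cdf_chi_square_1_ge[OF assms(1)] by simp
  show "bdd_below {t. 0 \<le> t \<and> 1 - \<delta> \<le> cdf chi_square_1 t}" by (rule bdd_belowI[of _ 0]) simp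
qed

lemma chi_square_1_inv_ge:
  assumes "0 < \<delta>" "0 \<le> t" "cdf chi_square_1 t < 1 - \<delta>"
  shows "t \<le> chi_square_1_inv (1 - \<delta>)"
  unfolding chi_square_1_inv_def
proof (rule cInf_greatest)
  \<comment> \<open>At this point the moment bound on the tail equals \<open>\<delta>\<close>. It
    witnesses that the set is nonempty, without which its infimum would be unspecified.\<close>
  have "3 / (sqrt (3 / \<delta>))\<^sup>2 = \<delta>" using assms(1) by simp
  then have "1 - \<delta> \<le> cdf chi_square_1 (sqrt (3 / \<delta>))"
    using cdf_chi_square_1_ge[of "sqrt (3 / \<delta>)"] assms(1) by simp
  then show "{t. 0 \<le> t \<and> 1 - \<delta> \<le> cdf chi_square_1 t} \<noteq> {}"
    using assms(1) by (auto intro!: exI[of _ "sqrt (3 / \<delta>)"])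
  fix s assume "s \<in> {t. 0 \<le> t \<and> 1 - \<delta> \<le> cdf chi_square_1 t}"
  then show "t \<le> s" using assms(3) cdf_chi_square_1_mono[of s t] by (cases "t \<le> s") auto
qed

text \<open>The CDF at any fixed level is strictly below 1, the limit of the arguments of the
  quantile, so every level is eventually exceeded.\<close>

lemma chi_square_1_inv_at_top:
  assumes "0 < a"
  shows "filterlim (\<lambda>n. chi_square_1_inv (1 - a / real n)) at_top sequentially"
  unfolding filterlim_at_top
proof
  fix Z :: real
  have lim: "(\<lambda>n. 1 - a / real n) \<longlonglongrightarrow> 1 - 0"
    by (intro tendsto_intros lim_const_over_n)
  have "eventually (\<lambda>n. cdf chi_square_1 (max Z 0) < 1 - a / real n) sequentially"
    using order_tendstoD(1)[OF lim] cdf_chi_square_1_less_1[of "max Z 0"] by simp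
  then show "eventually (\<lambda>n. Z \<le> chi_square_1_inv (1 - a / real n)) sequentially"
    using eventually_gt_at_top[of 0]
  proof eventually_elim
    case (elim n)
    then have "max Z 0 \<le> chi_square_1_inv (1 - a / real n)"
      using assms by (intro chi_square_1_inv_ge) auto
    then show ?case by simp
  qed
qed

lemma chi_square_1_inv_sublinear:
  assumes "0 < a" "0 < \<eta>"
  shows "eventually (\<lambda>n. chi_square_1_inv (1 - a / real n) \<le> \<eta> * real n) sequentially"
proof -
  \<comment> \<open>Beyond this bound \<open>3 / (\<eta> * real n)\<^sup>2\<close> is at most
    \<open>a / real n\<close>, so the moment bound places the quantile below
    \<open>\<eta> * real n\<close>.\<close>
  obtain N :: nat where N: "3 / (\<eta>\<^sup>2 * a) \<le> real N" using real_arch_simple by blast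
  show ?thesis using eventually_gt_at_top[of 0] eventually_ge_at_top[of N]
  proof eventually_elim
    case (elim n)
    then have "3 / (\<eta>\<^sup>2 * a) \<le> real n" using N by linarith
    then have "3 / (\<eta> * real n)\<^sup>2 \<le> a / real n"
      using assms elim by (simp add: field_simps power2_eq_square)
    then show ?case using assms elim by (intro chi_square_1_inv_le) auto
  qed
qed

section \<open>The greedy path\<close>

lemma sner_set_subset_card:
  assumes "dim_row X = L" "m \<le> L"
  shows "sner_set X y m \<subseteq> {..<L} \<and> card (sner_set X y m) = m"
  using assms(2)
proof (induction m)
  case (Suc m)
  let ?S = "sner_set X y m"
  have S: "?S \<subseteq> {..<L}" "card ?S = m" "finite ?S" using Suc finite_subset by auto
  have "card ({..<L} - ?S) = L - m" using S by (simp add: card_Diff_subset)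
  then have "{..<L} - ?S \<noteq> {}" using Suc.prems by (metis card.empty not_less_eq_eq diff_is_0_eq order_refl le_refl)
  then have "arg_min_on (\<lambda>j. min_emp_risk X y (insert j ?S)) ({..<L} - ?S) \<in> {..<L} - ?S"
    by (intro arg_min_if_finite) auto
  then show ?case using S assms(1) by auto
qed simp

lemma sner_set_greedy:
  assumes "dim_row X = L" "j \<in> {..<L} - sner_set X y m"
  shows "min_emp_risk X y (sner_set X y (Suc m)) \<le> min_emp_risk X y (insert j (sner_set X y m))"
  using arg_min_if_finite(2)[of "{..<L} - sner_set X y m" "\<lambda>j. min_emp_risk X y (insert j (sner_set X y m))"] assms
  by (force simp: not_less)

lemma sner_Lbar_full:
  assumes "dim_row X = L" "\<And>m. m < L \<Longrightarrow> \<tau> \<le> risk_decrease X y (Suc m)"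
  shows "sner_Lbar X y \<tau> = L"
proof -
  have "sner_Khat X y \<tau> = L"
    unfolding sner_Khat_def using assms by (intro Least_equality) (auto simp: not_le[symmetric])
  then show ?thesis using assms(1) by (simp add: sner_Lbar_def)
qed

lemma response_vec_design_mat:
  assumes "\<theta> \<in> carrier_vec L"
  shows "response_vec (design_mat L n x) \<theta> e = vec n (\<lambda>i. lin_fit L x (vec_index \<theta>) i + e i)"
proof -
  have "\<theta> = vec L (vec_index \<theta>)" using assms by auto
  then have "(design_mat L n x)\<^sup>T *\<^sub>v \<theta> = vec n (lin_fit L x (vec_index \<theta>))"
    using design_transpose_mult[of L n x "vec_index \<theta>"] by simp
  then show ?thesis by (auto simp: response_vec_def design_mat_def)
qed

section \<open>Probabilistic estimates\<close>

lemma measurable_mat_design_mat: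
  assumes "\<And>i j. j < L \<Longrightarrow> (\<lambda>\<omega>. x \<omega> i j) \<in> borel_measurable N"
  shows "measurable_mat N L n (\<lambda>\<omega>. design_mat L n (x \<omega>))"
  using assms by (simp add: measurable_mat_def design_mat_def)

lemma measurable_mat_gram_mat:
  assumes "measurable_mat N L n (\<lambda>\<omega>. design_mat L n (x \<omega>))"
  shows "measurable_mat N L L (\<lambda>\<omega>. gram_mat L n (x \<omega>))"
  unfolding gram_mat_def by (intro measurable_mat_mult[OF assms] measurable_mat_transpose[OF assms])

lemma measurable_mat_hat_mat:
  assumes "measurable_mat N L n (\<lambda>\<omega>. design_mat L n (x \<omega>))"
  shows "measurable_mat N n n (\<lambda>\<omega>. hat_mat L n (x \<omega>))"
  unfolding hat_mat_def
  by (intro measurable_mat_mult[OF measurable_mat_transpose[OF assms]] measurable_mat_mult[OF measurable_inv_mat]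
      measurable_mat_gram_mat assms)

lemma borel_measurable_mat_trace:
  assumes A: "measurable_mat N n n A"
  shows "(\<lambda>\<omega>. mat_trace (A \<omega>)) \<in> borel_measurable N"
  unfolding mat_trace_def measurable_matD(2)[OF A]
  by (rule borel_measurable_sum, rule measurable_matD(4)[OF A]) auto

lemma span_energy_ge_0: "0 \<le> span_energy L n x e"
  using span_energy_nonneg[of L n x e] hat_mat_singular[of L n x]
  by (cases "det (gram_mat L n x) = 0") (auto simp: span_energy_def)

lemma span_energy_le_span_energy:
  assumes "det (gram_mat L n x) \<noteq> 0" "span_energy L n x e \<le> H"
  shows "span_energy_le L n x e H"
  unfolding span_energy_le_def
  using span_energy_bound[OF assms(1)] assms(2)
  by (meson mult_right_mono order_trans sum_nonneg zero_le_power2)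

text \<open>All coefficients equal \<open>t\<close>, so every proper index set misses a strong
  feature, and the perturbation \<open>e\<close> has projected energy at most \<open>n\<close> by
  Cauchy-Schwarz. The guaranteed decrease grows like \<open>t\<^sup>2\<close> and passes any
  threshold. The coefficients here are fictitious: suitable noise makes the true response look like
  this.\<close>

lemma sner_Lbar_strong_signal:
  assumes fr: "full_row_rank L n x" and n: "0 < n" and L: "0 < L"
    and g: "\<And>v j. j < L \<Longrightarrow> (v j)\<^sup>2 \<le> g * (\<Sum>i<n. (lin_fit L x v i)\<^sup>2)" "0 < g"
    and B: "\<And>j. j < L \<Longrightarrow> (\<Sum>i<n. (x i j)\<^sup>2) \<le> B" "0 < B"
    and y: "\<And>i. y i = lin_fit L x (\<lambda>_. t) i + e i"
    and e: "(\<Sum>i<n. (e i)\<^sup>2) \<le> real n"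
    and t: "0 < t" "4 * real n * g \<le> t\<^sup>2" "\<tau> \<le> (t / (2 * g * real L))\<^sup>2 / B / real n"
  shows "sner_Lbar (design_mat L n x) (vec n y) \<tau> = L"
proof (rule sner_Lbar_full)
  show X: "dim_row (design_mat L n x) = L" by (simp add: design_mat_def)
  fix m assume m: "m < L"
  let ?I = "sner_set (design_mat L n x) (vec n y) m"
  have I: "?I \<subseteq> {..<L}" "card ?I = m"
    using sner_set_subset_card[OF X, of m] m by auto
  then have "?I \<subset> {..<L}" using m by auto
  moreover have "span_energy_le L n x e (real n)"
    unfolding span_energy_le_def
  proof
    fix v
    have "(\<Sum>i<n. lin_fit L x v i * e i)\<^sup>2 \<le> (\<Sum>i<n. (lin_fit L x v i)\<^sup>2) * (\<Sum>i<n. (e i)\<^sup>2)"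
      by (rule Cauchy_Schwarz_ineq_sum)
    also have "\<dots> \<le> (\<Sum>i<n. (lin_fit L x v i)\<^sup>2) * real n"
      by (intro mult_left_mono e sum_nonneg) auto
    finally show "(\<Sum>i<n. lin_fit L x v i * e i)\<^sup>2 \<le> real n * (\<Sum>i<n. (lin_fit L x v i)\<^sup>2)"
      by (simp add: mult.commute)
  qed
  ultimately obtain j where j: "j \<in> {..<L} - ?I"
    "(t\<^sup>2 / (2 * g * real L * t))\<^sup>2 / B / real n \<le> min_emp_risk (design_mat L n x) (vec n y) ?I
       - min_emp_risk (design_mat L n x) (vec n y) (insert j ?I)"
    using min_emp_risk_decrease_ge[OF fr order_refl, where I = ?I and \<theta> = "\<lambda>_. t" and a = t and b = t
        and y = y and e = e and H = "real n" and g = g and B = B] y g B t n by auto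
  moreover have "t\<^sup>2 / (2 * g * real L * t) = t / (2 * g * real L)"
    using t by (simp add: power2_eq_square)
  ultimately show "\<tau> \<le> risk_decrease (design_mat L n x) (vec n y) (Suc m)"
    using t(3) sner_set_greedy[OF X j(1)] unfolding risk_decrease_def by simp
qed

context prob_space
begin

lemma indep_var_of_indep_sigma_algebras:
  fixes f g :: "'a \<Rightarrow> real"
  assumes sp: "space F = space M" "space E = space M" and ind: "indep_set (sets F) (sets E)"
    and f: "f \<in> borel_measurable F" and g: "g \<in> borel_measurable E"
  shows "indep_var borel f borel g"
proof -
  have ev: "sets F \<subseteq> events" "sets E \<subseteq> events" 
    and pr: "\<And>a b. a \<in> sets F \<Longrightarrow> b \<in> sets E \<Longrightarrow> prob (a \<inter> b) = prob a * prob b"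
    using ind unfolding indep_sets2_eq by auto
  have F: "sigma_sets (space M) {f -` A \<inter> space M |A. A \<in> sets borel} \<subseteq> sets F"
    using sets.sigma_sets_subset[of "{f -` A \<inter> space M |A. A \<in> sets borel}" F] measurable_sets[OF f] sp by auto
  have E: "sigma_sets (space M) {g -` A \<inter> space M |A. A \<in> sets borel} \<subseteq> sets E"
    using sets.sigma_sets_subset[of "{g -` A \<inter> space M |A. A \<in> sets borel}" E] measurable_sets[OF g] sp by auto
  have "f \<in> borel_measurable M" "g \<in> borel_measurable M"
    using measurable_sets[OF f] measurable_sets[OF g] ev sp by (auto intro!: measurableI)
  moreover have "indep_set (sigma_sets (space M) {f -` A \<inter> space M |A. A \<in> sets borel})
      (sigma_sets (space M) {g -` A \<inter> space M |A. A \<in> sets borel})"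
    unfolding indep_sets2_eq using F E ev pr by blast
  ultimately show ?thesis unfolding indep_var_eq by blast
qed

text \<open>Independence of features and noise factors each expectation. The off-diagonal
  covariances vanish, the diagonal leaves \<open>\<sigma>\<^sup>2\<close> times the expected trace
  of the projection matrix, and Markov's inequality concludes.\<close>

lemma span_energy_tail:
  fixes \<epsilon> :: "nat \<Rightarrow> 'a \<Rightarrow> real"
  assumes sp: "space F = space M" "space E = space M" and ind: "indep_set (sets F) (sets E)"
    and x: "\<And>i j. j < L \<Longrightarrow> (\<lambda>\<omega>. x \<omega> i j) \<in> borel_measurable F"
    and \<epsilon>: "\<And>i. \<epsilon> i \<in> borel_measurable E"
    and int: "\<And>a b. integrable M (\<lambda>\<omega>. \<epsilon> a \<omega> * \<epsilon> b \<omega>)"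
    and cov: "\<And>a b. expectation (\<lambda>\<omega>. \<epsilon> a \<omega> * \<epsilon> b \<omega>) = (if a = b then \<sigma>\<^sup>2 else 0)"
    and t: "0 < t"
  shows "prob {\<omega>\<in>space M. t \<le> span_energy L n (x \<omega>) (\<lambda>i. \<epsilon> i \<omega>)} \<le> \<sigma>\<^sup>2 * real L / t"
proof -
  have subF: "sets F \<subseteq> events" using ind unfolding indep_sets2_eq by auto
  let ?P = "\<lambda>a b \<omega>. hat_mat L n (x \<omega>) $$ (a, b)"
  have PF: "?P a b \<in> borel_measurable F" if "a < n" "b < n" for a b
    using measurable_matD(4)[OF measurable_mat_hat_mat[OF measurable_mat_design_mat[OF x]] that] .
  have PM: "?P a b \<in> borel_measurable M" if "a < n" "b < n" for a b
    using measurable_sets[OF PF[OF that]] subF sp by (auto intro!: measurableI)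
  have Pi: "integrable M (?P a b)" if "a < n" "b < n" for a b
    using PM[OF that] hat_mat_bounded[OF that]
    by (intro integrable_const_bound[where B = 1]) auto
  have iv: "indep_var borel (?P a b) borel (\<lambda>\<omega>. \<epsilon> a \<omega> * \<epsilon> b \<omega>)" if "a < n" "b < n" for a b
    using \<epsilon> by (intro indep_var_of_indep_sigma_algebras[OF sp ind] PF that) simp
  have pi: "integrable M (\<lambda>\<omega>. ?P a b \<omega> * (\<epsilon> a \<omega> * \<epsilon> b \<omega>))" if "a < n" "b < n" for a b
    by (rule indep_var_integrable[OF iv[OF that] Pi[OF that] int])
  have pe: "expectation (\<lambda>\<omega>. ?P a b \<omega> * (\<epsilon> a \<omega> * \<epsilon> b \<omega>)) = expectation (?P a b) * (if a = b then \<sigma>\<^sup>2 else 0)"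
    if "a < n" "b < n" for a b
    using indep_var_lebesgue_integral[OF iv[OF that] Pi[OF that] int] cov[of a b] by simp
  have si: "integrable M (\<lambda>\<omega>. span_energy L n (x \<omega>) (\<lambda>i. \<epsilon> i \<omega>))"
    unfolding span_energy_def by (intro Bochner_Integration.integrable_sum pi) auto
  have "expectation (\<lambda>\<omega>. span_energy L n (x \<omega>) (\<lambda>i. \<epsilon> i \<omega>))
      = (\<Sum>a<n. \<Sum>b<n. expectation (\<lambda>\<omega>. ?P a b \<omega> * (\<epsilon> a \<omega> * \<epsilon> b \<omega>)))"
    unfolding span_energy_def
    by (subst Bochner_Integration.integral_sum, (intro Bochner_Integration.integrable_sum pi; simp),
        intro sum.cong refl, subst Bochner_Integration.integral_sum) (auto intro: pi)
  also have "\<dots> = (\<Sum>a<n. \<Sum>b<n. if b = a then expectation (?P a b) * \<sigma>\<^sup>2 else 0)"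
    by (intro sum.cong refl) (auto simp: pe)
  also have "\<dots> = (\<Sum>a<n. expectation (?P a a)) * \<sigma>\<^sup>2"
    by (simp add: sum_distrib_right)
  also have "(\<Sum>a<n. expectation (?P a a)) = expectation (\<lambda>\<omega>. \<Sum>a<n. ?P a a \<omega>)"
    by (subst Bochner_Integration.integral_sum) (auto intro: Pi)
  also have "\<dots> \<le> expectation (\<lambda>_. real L)"
    by (intro integral_mono Bochner_Integration.integrable_sum Pi integrable_const hat_mat_trace) auto
  also have "\<dots> = real L" by (simp add: prob_space)
  finally have "expectation (\<lambda>\<omega>. span_energy L n (x \<omega>) (\<lambda>i. \<epsilon> i \<omega>)) \<le> \<sigma>\<^sup>2 * real L"
    by (simp add: mult_right_mono mult.commute)
  moreover have "prob {\<omega>\<in>space M. t \<le> span_energy L n (x \<omega>) (\<lambda>i. \<epsilon> i \<omega>)}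
      \<le> expectation (\<lambda>\<omega>. span_energy L n (x \<omega>) (\<lambda>i. \<epsilon> i \<omega>)) / t"
    using integral_Markov_inequality_measure[OF si sets.empty_sets _ t] span_energy_ge_0 by simp
  ultimately show ?thesis using t by (meson divide_right_mono less_imp_le order_trans)
qed

lemma normal_noise_moments:
  fixes \<epsilon> :: "nat \<Rightarrow> 'a \<Rightarrow> real"
  assumes \<sigma>: "0 < \<sigma>" and ind: "indep_vars (\<lambda>_. borel) \<epsilon> UNIV"
    and D: "\<And>i. distributed M lborel (\<epsilon> i) (normal_density 0 \<sigma>)"
  shows "integrable M (\<lambda>\<omega>. \<epsilon> a \<omega> * \<epsilon> b \<omega>)"
    and "expectation (\<lambda>\<omega>. \<epsilon> a \<omega> * \<epsilon> b \<omega>) = (if a = b then \<sigma>\<^sup>2 else 0)"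
proof -
  have i1: "integrable M (\<epsilon> i)" for i
    using distributed_integrable[OF D, of "\<lambda>x. x" i] integrable_normal_moment[OF \<sigma>, of 0 1] by simp
  have i2: "integrable M (\<lambda>\<omega>. \<epsilon> i \<omega> * \<epsilon> i \<omega>)" for i
    using distributed_integrable[OF D, of "\<lambda>x. x * x" i] integrable_normal_moment[OF \<sigma>, of 0 2]
    by (simp add: power2_eq_square)
  have e1: "expectation (\<epsilon> i) = 0" for i by (rule normal_distributed_expectation[OF \<sigma> D])
  have e2: "expectation (\<lambda>\<omega>. \<epsilon> i \<omega> * \<epsilon> i \<omega>) = \<sigma>\<^sup>2" for i
    using normal_distributed_variance[OF \<sigma> D, of i] e1 by (simp add: power2_eq_square)
  have iv: "indep_var borel (\<epsilon> a) borel (\<epsilon> b)" if "a \<noteq> b"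
  proof -
    let ?F = "\<lambda>i. sigma_sets (space M) {\<epsilon> i -` A \<inter> space M |A. A \<in> sets borel}"
    have rv: "\<And>i. random_variable borel (\<epsilon> i)" and isets: "indep_sets ?F UNIV"
      using ind unfolding indep_vars_def by auto
    have "prob (A \<inter> B) = prob A * prob B" if "A \<in> ?F a" "B \<in> ?F b" for A B
      using indep_setsD[OF isets, of "{a, b}" "\<lambda>i. if i = a then A else B"] that \<open>a \<noteq> b\<close>
      by (simp add: Int_commute mult.commute)
    moreover have "?F i \<subseteq> events" for i using isets unfolding indep_sets_def by auto
    ultimately show ?thesis unfolding indep_var_eq indep_sets2_eq using rv by blast
  qed
  show "integrable M (\<lambda>\<omega>. \<epsilon> a \<omega> * \<epsilon> b \<omega>)"
    using i2 indep_var_integrable[OF iv i1 i1] by (cases "a = b") auto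
  show "expectation (\<lambda>\<omega>. \<epsilon> a \<omega> * \<epsilon> b \<omega>) = (if a = b then \<sigma>\<^sup>2 else 0)"
    using e2 indep_var_lebesgue_integral[OF iv i1 i1] e1 by (cases "a = b") auto
qed

lemma normal_noise_box_pos:
  fixes \<epsilon> :: "nat \<Rightarrow> 'a \<Rightarrow> real"
  assumes \<sigma>: "0 < \<sigma>" and ind: "indep_vars (\<lambda>_. borel) \<epsilon> UNIV"
    and D: "\<And>i. distributed M lborel (\<epsilon> i) (normal_density 0 \<sigma>)" and r: "0 < r"
  shows "0 < prob {\<omega>\<in>space M. \<forall>i<n. \<bar>\<epsilon> i \<omega> - q i\<bar> < r}"
proof (cases "n = 0")
  case True
  then show ?thesis by (simp add: prob_space)
next
  case False
  let ?A = "\<lambda>i. {q i - r<..<q i + r}"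
  have m: "\<epsilon> i \<in> borel_measurable M" for i using distributed_measurable[OF D] by simp
  have "{\<omega>\<in>space M. \<forall>i<n. \<bar>\<epsilon> i \<omega> - q i\<bar> < r} = (\<Inter>i\<in>{..<n}. \<epsilon> i -` ?A i \<inter> space M)"
    using False by (auto simp: abs_less_iff)
  then have "prob {\<omega>\<in>space M. \<forall>i<n. \<bar>\<epsilon> i \<omega> - q i\<bar> < r} = (\<Prod>i<n. prob (\<epsilon> i -` ?A i \<inter> space M))"
    using indep_varsD[OF ind, of "{..<n}" ?A] False by (simp add: lessThan_empty_iff)
  moreover have "0 < prob (\<epsilon> i -` ?A i \<inter> space M)" for i
  proof -
    have "prob (\<epsilon> i -` ?A i \<inter> space M) = measure (distr M lborel (\<epsilon> i)) (?A i)"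
      using m by (subst measure_distr) auto
    also have "\<dots> = measure (density lborel (normal_density 0 \<sigma>)) (?A i)"
      using distributed_distr_eq_density[OF D] by simp
    finally show ?thesis using measure_normal_density_interval_pos[OF \<sigma>, of "q i - r" "q i + r" 0] r by simp
  qed
  ultimately show ?thesis by (simp add: prod_pos)
qed

lemma prob_tendsto_1_mono:
  assumes T: "\<And>n. T n \<in> events" and sub: "\<forall>\<^sub>F n in sequentially. AE \<omega> in M. \<omega> \<in> G n \<longrightarrow> \<omega> \<in> T n"
    and G: "(\<lambda>n. prob (G n)) \<longlonglongrightarrow> 1"
  shows "(\<lambda>n. prob (T n)) \<longlonglongrightarrow> 1"
proof (rule tendsto_sandwich[OF _ _ G tendsto_const])
  show "\<forall>\<^sub>F n in sequentially. prob (G n) \<le> prob (T n)"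
    using sub by eventually_elim (use T in \<open>auto intro!: finite_measure_mono_AE\<close>)
qed simp

lemma prob_Int_tendsto_1:
  assumes A: "\<And>n. A n \<in> events" "(\<lambda>n. prob (A n)) \<longlonglongrightarrow> 1"
    and B: "\<And>n. B n \<in> events" "(\<lambda>n. prob (B n)) \<longlonglongrightarrow> 1"
  shows "(\<lambda>n. prob (A n \<inter> B n)) \<longlonglongrightarrow> 1"
proof (rule tendsto_sandwich[OF _ _ _ tendsto_const])
  have "(\<lambda>n. prob (A n) + prob (B n) - 1) \<longlonglongrightarrow> 1 + 1 - 1"
    by (intro tendsto_intros A B)
  then show "(\<lambda>n. prob (A n) + prob (B n) - 1) \<longlonglongrightarrow> 1" by simp
  show "\<forall>\<^sub>F n in sequentially. prob (A n) + prob (B n) - 1 \<le> prob (A n \<inter> B n)"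
  proof (intro always_eventually allI)
    fix n
    have "prob (A n \<union> B n) = prob (A n) + prob (B n) - prob (A n \<inter> B n)"
      using finite_measure_Union'[of "A n" "B n"] finite_measure_Diff'[of "B n" "A n"] A B by (simp add: Int_commute)
    then show "prob (A n) + prob (B n) - 1 \<le> prob (A n \<inter> B n)"
      using prob_le_1[of "A n \<union> B n"] by linarith
  qed
qed simp

text \<open>Dominated convergence of indicators. It converts bounds that hold from an
  outcome-dependent sample size on into probabilities at fixed \<open>n\<close>.\<close>

lemma prob_tendsto_1_of_AE_eventually:
  assumes Q: "\<And>n. {\<omega>\<in>space M. Q n \<omega>} \<in> events"
    and ev: "AE \<omega> in M. \<forall>\<^sub>F n in sequentially. Q n \<omega>"
  shows "(\<lambda>n. prob {\<omega>\<in>space M. Q n \<omega>}) \<longlonglongrightarrow> 1"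
proof -
  have "(\<lambda>n. expectation (indicator {\<omega>\<in>space M. Q n \<omega>} :: 'a \<Rightarrow> real)) \<longlonglongrightarrow> expectation (\<lambda>_. 1 :: real)"
  proof (rule integral_dominated_convergence[where w = "\<lambda>_. 1"])
    show "AE \<omega> in M. (\<lambda>n. indicator {\<omega>\<in>space M. Q n \<omega>} \<omega> :: real) \<longlonglongrightarrow> 1"
      using ev AE_space
    proof eventually_elim
      case (elim \<omega>)
      then show ?case by (intro tendsto_eventually) (auto elim!: eventually_mono)
    qed
  qed (use Q in auto)
  then show ?thesis using Q by (simp add: prob_space)
qed

end

section \<open>The full Gram matrix\<close>

lemma mat_trace_ge_column_norm:
  assumes "j < L"
  shows "(\<Sum>i<n. (x i j)\<^sup>2) \<le> mat_trace (gram_mat L n x)"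
proof -
  have "mat_trace (gram_mat L n x) = (\<Sum>k<L. \<Sum>i<n. (x i k)\<^sup>2)"
    unfolding mat_trace_def using gram_mat_carrier[of L n x]
    by (auto simp: gram_mat_index power2_eq_square)
  moreover have "(\<Sum>i<n. (x i j)\<^sup>2) \<le> (\<Sum>k<L. \<Sum>i<n. (x i k)\<^sup>2)"
    using assms by (intro member_le_sum[of j "{..<L}" "\<lambda>k. \<Sum>i<n. (x i k)\<^sup>2"]) (auto intro: sum_nonneg)
  ultimately show ?thesis by simp
qed

lemma coeff_bound_mono:
  assumes "det (gram_mat L n x) \<noteq> 0" "j < L" "mat_trace (inv_mat (gram_mat L n x)) \<le> g"
  shows "(v j)\<^sup>2 \<le> g * (\<Sum>i<n. (lin_fit L x v i)\<^sup>2)"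
  using coeff_bound[OF assms(1,2), of v] mult_right_mono[OF assms(3), of "\<Sum>i<n. (lin_fit L x v i)\<^sup>2"]
  by (meson order_trans sum_nonneg zero_le_power2)

text \<open>The strength \<open>t\<close> is a natural number so that countably many strengths cover
  all outcomes, although \<open>g\<close> and \<open>B\<close> vary with the features.\<close>

lemma exists_signal_strength:
  fixes g B \<tau> :: real
  assumes "0 < L" "0 < g" "0 < B"
  shows "\<exists>t::nat. 0 < t \<and> 4 * real L * g \<le> (real t)\<^sup>2
    \<and> \<tau> \<le> (real t / (2 * g * real L))\<^sup>2 / B / real L"
proof -
  \<comment> \<open>Being at least 1, \<open>h\<close> satisfies \<open>h \<le> h\<^sup>2\<close>,
    so a \<open>t\<close> linear in \<open>h\<close> suffices and no square root of the target is
    taken.\<close>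
  define h where "h = max 1 (\<tau> * B * real L)"
  obtain t :: nat where t: "max (max 1 (4 * real L * g)) (2 * g * real L * h) \<le> real t"
    using real_arch_simple by blast
  have 1: "1 \<le> real t" using t by simp
  then have "real t \<le> (real t)\<^sup>2" by (simp add: power2_eq_square)
  moreover have "4 * real L * g \<le> real t" using t by simp
  ultimately have 2: "4 * real L * g \<le> (real t)\<^sup>2" by linarith
  have "h \<le> real t / (2 * g * real L)" using t assms by (simp add: field_simps)
  then have "h\<^sup>2 \<le> (real t / (2 * g * real L))\<^sup>2" by (intro power_mono) (auto simp: h_def)
  moreover have "h \<le> h\<^sup>2" by (rule self_le_power) (auto simp: h_def)
  moreover have "\<tau> * B * real L \<le> h" by (simp add: h_def)
  ultimately have "\<tau> * B * real L \<le> (real t / (2 * g * real L))\<^sup>2" by linarith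
  then have "\<tau> \<le> (real t / (2 * g * real L))\<^sup>2 / B / real L"
    using assms by (simp add: field_simps)
  then show ?thesis using 1 2 by (intro exI[of _ t]) auto
qed

lemma exists_rational_approx:
  fixes f :: "nat \<Rightarrow> real"
  assumes "0 < r"
  shows "\<exists>q\<in>{..<n} \<rightarrow>\<^sub>E \<rat>. \<forall>i<n. \<bar>f i - q i\<bar> < r"
proof -
  have "\<exists>z\<in>\<rat>. \<bar>f i - z\<bar> < r" for i
    using Rats_dense_in_real[of "f i - r" "f i + r"] assms by (force simp: abs_less_iff)
  then obtain z where "\<And>i. z i \<in> \<rat>" "\<And>i. \<bar>f i - z i\<bar> < r" by metis
  then show ?thesis by (intro bexI[of _ "restrict z {..<n}"]) auto
qed

context prob_space
begin

text \<open>Given the features, the noise charges every open box, in particular the boxes on which the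
  response is a strong signal in all features; there the procedure accepts all of them. Such a box
  depends on the features, but countably many rational boxes suffice, so that independence can be
  applied box by box.\<close>
lemma null_of_null_full_path:
  fixes \<epsilon> :: "nat \<Rightarrow> 'a \<Rightarrow> real"
  assumes sp: "space F = space M" "space E = space M" and ind: "indep_set (sets F) (sets E)"
    and x: "\<And>i j. j < L \<Longrightarrow> (\<lambda>\<omega>. x \<omega> i j) \<in> borel_measurable F"
    and \<epsilon>: "\<And>i. \<epsilon> i \<in> borel_measurable E"
    and \<sigma>: "0 < \<sigma>" and iv: "indep_vars (\<lambda>_. borel) \<epsilon> UNIV"
    and D: "\<And>i. distributed M lborel (\<epsilon> i) (normal_density 0 \<sigma>)"
    and L: "0 < L" and A: "A \<in> sets F"
    and fr: "AE \<omega> in M. full_row_rank L L (x \<omega>)"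
    and null: "AE \<omega> in M. sner_Lbar (design_mat L L (x \<omega>))
        (vec L (\<lambda>i. lin_fit L (x \<omega>) \<theta> i + \<epsilon> i \<omega>)) \<tau> = L \<longrightarrow> \<omega> \<notin> A"
  shows "AE \<omega> in M. \<omega> \<notin> A"
proof -
  have subF: "sets F \<subseteq> events" and subE: "sets E \<subseteq> events"
    using ind unfolding indep_sets2_eq by auto
  define g where "g \<omega> = \<bar>mat_trace (inv_mat (gram_mat L L (x \<omega>)))\<bar> + 1" for \<omega>
  define B where "B \<omega> = \<bar>mat_trace (gram_mat L L (x \<omega>))\<bar> + 1" for \<omega>
  \<comment> \<open>The noise that would turn the true response into one whose coefficients all
    equal \<open>t\<close>.\<close>
  define s where "s t \<omega> i = lin_fit L (x \<omega>) (\<lambda>j. real t - \<theta> j) i" for t :: nat and \<omega> i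
  define ok where "ok t \<omega> \<longleftrightarrow> 0 < t \<and> 4 * real L * g \<omega> \<le> (real t)\<^sup>2
    \<and> \<tau> \<le> (real t / (2 * g \<omega> * real L))\<^sup>2 / B \<omega> / real L" for t :: nat and \<omega>
  \<comment> \<open>\<open>U\<close> depends on the features and \<open>W\<close> on the noise only;
    they are linked by the fixed point \<open>q\<close>. On both, each noise value is within
    \<open>1/2 + 1/2\<close> of \<open>s t\<close>, which leaves a perturbation of energy at most
    \<open>L\<close>.\<close>
  define U where "U q t = {\<omega>\<in>space F. \<omega> \<in> A \<and> ok t \<omega> \<and> (\<forall>i<L. \<bar>s t \<omega> i - q i\<bar> < 1/2)}" for q t
  define W where "W q = {\<omega>\<in>space E. \<forall>i<L. \<bar>\<epsilon> i \<omega> - q i\<bar> < 1/2}" for q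
  note X = measurable_mat_design_mat[OF x, of L]
  note G = measurable_mat_gram_mat[OF X]
  have [measurable]: "g \<in> borel_measurable F" "B \<in> borel_measurable F"
    unfolding g_def B_def
    using borel_measurable_mat_trace[OF G] borel_measurable_mat_trace[OF measurable_inv_mat[OF G]]
    by (intro borel_measurable_add borel_measurable_abs borel_measurable_const; simp)+
  have [measurable]: "(\<lambda>\<omega>. s t \<omega> i) \<in> borel_measurable F" for t i
    unfolding s_def lin_fit_def by (intro borel_measurable_sum borel_measurable_times borel_measurable_const x) simp
  have U: "U q t \<in> sets F" for q t
    unfolding U_def ok_def using A by measurable
  have W: "W q \<in> sets E" for q
    unfolding W_def using \<epsilon> by measurable
  have W0: "0 < prob (W q)" for q
    unfolding W_def sp by (rule normal_noise_box_pos[OF \<sigma> iv D]) simp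
  have "AE \<omega> in M. \<omega> \<notin> U q t" for q t
  proof -
    have "AE \<omega> in M. \<omega> \<notin> U q t \<inter> W q"
      using fr null
    proof eventually_elim
      case (elim \<omega>)
      show ?case
      proof
        assume \<omega>: "\<omega> \<in> U q t \<inter> W q"
        define e where "e i = (if i < L then \<epsilon> i \<omega> - s t \<omega> i else 0)" for i
        have e1: "\<bar>e i\<bar> \<le> 1" for i
        proof (cases "i < L")
          case True
          then have "\<bar>\<epsilon> i \<omega> - q i\<bar> < 1/2" "\<bar>s t \<omega> i - q i\<bar> < 1/2"
            using \<omega> unfolding U_def W_def by auto
          then have "\<bar>\<epsilon> i \<omega> - s t \<omega> i\<bar> \<le> 1" by linarith
          then show ?thesis using True by (simp add: e_def)
        qed (simp add: e_def)
        have y: "vec L (\<lambda>i. lin_fit L (x \<omega>) \<theta> i + \<epsilon> i \<omega>) = vec L (\<lambda>i. lin_fit L (x \<omega>) (\<lambda>_. real t) i + e i)"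
          by (rule eq_vecI) (auto simp: e_def s_def lin_fit_diff)
        have "(\<Sum>i<L. (e i)\<^sup>2) \<le> (\<Sum>i<L. 1)" 
          using e1 by (intro sum_mono) (simp add: abs_square_le_1)
        then have e: "(\<Sum>i<L. (e i)\<^sup>2) \<le> real L" by simp
        have d: "det (gram_mat L L (x \<omega>)) \<noteq> 0" by (rule full_row_rank_det_gram[OF elim(1)])
        have gb: "\<And>v j. j < L \<Longrightarrow> (v j)\<^sup>2 \<le> g \<omega> * (\<Sum>i<L. (lin_fit L (x \<omega>) v i)\<^sup>2)"
          by (rule coeff_bound_mono[OF d]) (auto simp: g_def)
        have Bb: "(\<Sum>i<L. (x \<omega> i j)\<^sup>2) \<le> B \<omega>" if "j < L" for j
          using mat_trace_ge_column_norm[OF that, of "x \<omega>" L] unfolding B_def by linarith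
        have okt: "ok t \<omega>" using \<omega> by (simp add: U_def)
        have "sner_Lbar (design_mat L L (x \<omega>)) (vec L (\<lambda>i. lin_fit L (x \<omega>) \<theta> i + \<epsilon> i \<omega>)) \<tau> = L"
          unfolding y
          by (rule sner_Lbar_strong_signal[OF elim(1) L L gb _ Bb _ refl e])
            (use okt in \<open>auto simp: ok_def g_def B_def\<close>)
        then show False using elim(2) \<omega> by (simp add: U_def)
      qed
    qed
    moreover have "U q t \<inter> W q \<in> events" using U W subF subE by blast
    ultimately have "prob (U q t \<inter> W q) = 0" by (simp add: prob_eq_0)
    then have "prob (U q t) * prob (W q) = 0" using indep_setD[OF ind U W] by simp
    then have "prob (U q t) = 0" using W0[of q] by simp
    then show ?thesis using U subF by (subst (asm) prob_eq_0) auto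
  qed
  then have "AE \<omega> in M. \<forall>q\<in>{..<L} \<rightarrow>\<^sub>E \<rat>. \<forall>t. \<omega> \<notin> U q t"
    by (subst AE_ball_countable) (auto intro!: countable_PiE countable_rat simp: AE_all_countable)
  then show ?thesis using AE_space
  proof eventually_elim
    case (elim \<omega>)
    show ?case
    proof
      assume "\<omega> \<in> A"
      have "0 < g \<omega>" "0 < B \<omega>" by (auto simp: g_def B_def)
      then obtain t where "ok t \<omega>" unfolding ok_def using exists_signal_strength[OF L] by blast
      moreover obtain q where "q \<in> {..<L} \<rightarrow>\<^sub>E \<rat>" "\<forall>i<L. \<bar>s t \<omega> i - q i\<bar> < 1/2"
        using exists_rational_approx[of "1/2" L "s t \<omega>"] by auto
      ultimately show False using elim \<open>\<omega> \<in> A\<close> sp unfolding U_def by blast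
    qed
  qed
qed

end

lemma positive_definite_det_nonzero:
  assumes "positive_definite_mat k A"
  shows "det A \<noteq> 0"
proof
  assume "det A = 0"
  moreover have A: "A \<in> carrier_mat k k" using assms by (simp add: positive_definite_mat_def)
  ultimately obtain v where "v \<in> carrier_vec k" "v \<noteq> 0\<^sub>v k" "A *\<^sub>v v = 0\<^sub>v k"
    using det_0_iff_vec_prod_zero_field[OF A] by auto
  moreover from this have "0 < v \<bullet> (A *\<^sub>v v)" using assms by (auto simp: positive_definite_mat_def)
  ultimately show False by simp
qed

text \<open>The inverse of \<open>G / n\<close> is \<open>n\<close> times the inverse of
  \<open>G\<close>. Both traces are therefore controlled by their limits, one of order
  \<open>1 / n\<close> and the other of order \<open>n\<close>.\<close>

lemma gram_trace_bounds:
  assumes M: "M \<in> carrier_mat L L" "det M \<noteq> 0"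
    and lim: "\<And>i j. i < L \<Longrightarrow> j < L \<Longrightarrow> (\<lambda>n. ((1 / real n) \<cdot>\<^sub>m gram_mat L n x) $$ (i, j)) \<longlonglongrightarrow> M $$ (i, j)"
    and d: "\<And>n. L \<le> n \<Longrightarrow> det (gram_mat L n x) \<noteq> 0"
  shows "\<forall>\<^sub>F n in sequentially.
      mat_trace (inv_mat (gram_mat L n x)) \<le> (\<bar>mat_trace (inv_mat M)\<bar> + 1) / real n \<and>
      mat_trace (gram_mat L n x) \<le> real n * (\<bar>mat_trace M\<bar> + 1)"
proof -
  let ?G = "\<lambda>n. (1 / real n) \<cdot>\<^sub>m gram_mat L n x"
  have G: "?G n \<in> carrier_mat L L" for n using gram_mat_carrier[of L n x] by simp
  have "(\<lambda>n. \<Sum>j<L. inv_mat (?G n) $$ (j, j)) \<longlonglongrightarrow> (\<Sum>j<L. inv_mat M $$ (j, j))"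
    by (rule tendsto_sum, rule tendsto_inv_mat[OF G M(1) lim M(2)]) auto
  then have "\<forall>\<^sub>F n in sequentially. (\<Sum>j<L. inv_mat (?G n) $$ (j, j)) < \<bar>\<Sum>j<L. inv_mat M $$ (j, j)\<bar> + 1"
    by (rule order_tendstoD) linarith
  moreover have "(\<lambda>n. \<Sum>j<L. ?G n $$ (j, j)) \<longlonglongrightarrow> (\<Sum>j<L. M $$ (j, j))"
    by (rule tendsto_sum, rule lim) auto
  then have "\<forall>\<^sub>F n in sequentially. (\<Sum>j<L. ?G n $$ (j, j)) < \<bar>\<Sum>j<L. M $$ (j, j)\<bar> + 1"
    by (rule order_tendstoD) linarith
  ultimately show ?thesis using eventually_ge_at_top[of L] eventually_gt_at_top[of 0]
  proof eventually_elim
    case (elim n)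
    have n: "0 < real n" using elim by simp
    have iG: "inv_mat (?G n) = real n \<cdot>\<^sub>m inv_mat (gram_mat L n x)"
      using inv_mat_smult[OF gram_mat_carrier d, of n "1 / real n"] elim by simp
    have c: "inv_mat (gram_mat L n x) \<in> carrier_mat L L" "inv_mat M \<in> carrier_mat L L"
      using inv_mat_carrier[OF gram_mat_carrier] inv_mat_carrier[OF M(1)] by auto
    have "(\<Sum>j<L. inv_mat (?G n) $$ (j, j)) = real n * mat_trace (inv_mat (gram_mat L n x))"
      unfolding iG mat_trace_def using c by (auto simp: sum_distrib_left)
    moreover have "(\<Sum>j<L. ?G n $$ (j, j)) = mat_trace (gram_mat L n x) / real n"
      unfolding mat_trace_def using gram_mat_carrier[of L n x] by (auto simp: sum_divide_distrib)
    moreover have "mat_trace (inv_mat M) = (\<Sum>j<L. inv_mat M $$ (j, j))" "mat_trace M = (\<Sum>j<L. M $$ (j, j))"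
      unfolding mat_trace_def using c M by auto
    ultimately have "real n * mat_trace (inv_mat (gram_mat L n x)) < \<bar>mat_trace (inv_mat M)\<bar> + 1"
      "mat_trace (gram_mat L n x) / real n < \<bar>mat_trace M\<bar> + 1"
      using elim by simp_all
    then show ?case
      using n by (simp add: pos_le_divide_eq pos_divide_less_eq mult.commute less_imp_le)
  qed
qed

text \<open>Both \<open>Lbar\<close> and the index sets are random. The conditions on them therefore
  stand inside the event, as premises of an implication, while \<open>k\<close> runs over the fixed
  range up to \<open>L\<close>.\<close>

theorem theorem6:
  fixes P :: "'a measure"
    and x :: "nat \<Rightarrow> nat \<Rightarrow> 'a \<Rightarrow> real"
    and \<epsilon> :: "nat \<Rightarrow> 'a \<Rightarrow> real"
    and \<theta> :: "real vec"
    and \<sigma> c c\<^sub>1 :: real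
    and L K :: nat
    and S :: "nat set"
    and M :: "nat set \<Rightarrow> real mat"
    and X :: "nat \<Rightarrow> 'a \<Rightarrow> real mat"
    and y :: "nat \<Rightarrow> 'a \<Rightarrow> real vec"
    and \<delta> \<tau> :: "nat \<Rightarrow> real"
    and \<I> :: "nat \<Rightarrow> 'a \<Rightarrow> nat \<Rightarrow> nat set"
    and Lbar :: "nat \<Rightarrow> 'a \<Rightarrow> nat"
  defines "X \<equiv> \<lambda>n \<omega>. design_mat L n (\<lambda>i j. x i j \<omega>)"
    and "y \<equiv> \<lambda>n \<omega>. response_vec (X n \<omega>) \<theta> (\<lambda>i. \<epsilon> i \<omega>)"
    and "S \<equiv> vec_support \<theta>"
    and "\<delta> \<equiv> \<lambda>n. c\<^sub>1 * (\<sigma>\<^sup>2 / real n)"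
    and "\<tau> \<equiv> \<lambda>n. sner_threshold \<sigma> c n (\<delta> n)"
    and "\<I> \<equiv> \<lambda>n \<omega>. sner_set (X n \<omega>) (y n \<omega>)"
    and "Lbar \<equiv> \<lambda>n \<omega>. sner_Lbar (X n \<omega>) (y n \<omega>) (\<tau> n)"
  assumes "prob_space P"
    and "\<sigma> > 0" "c > 0" "c\<^sub>1 > 0"
    and "\<theta> \<in> carrier_vec L" "card S = K" "1 \<le> K" "K \<le> L"
    and noise_indep: "prob_space.indep_vars P (\<lambda>_. borel) \<epsilon> UNIV"
    and noise_normal: "\<And>i. distributed P lborel (\<epsilon> i) (normal_density 0 \<sigma>)"
    and noise_features_indep:
      "prob_space.indep_set P
         (sets (vimage_algebra (space P)
            (\<lambda>\<omega>. \<lambda>(i, j)\<in>UNIV \<times> {..<L}. x i j \<omega>) (\<Pi>\<^sub>M (i, j)\<in>UNIV \<times> {..<L}. borel)))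
         (sets (vimage_algebra (space P) (\<lambda>\<omega> i. \<epsilon> i \<omega>) (\<Pi>\<^sub>M i\<in>UNIV. borel)))"
    and full_rank: "AE \<omega> in P. \<forall>n. vec_space.rank L (X n \<omega>) = min L n"
    and sparse_riesz:
      "AE \<omega> in P. \<forall>I\<subseteq>{..<L}. (\<exists>n\<ge>1. card I \<le> Lbar n \<omega>) \<longrightarrow>
         positive_definite_mat (card I) (M I) \<and>
         mat_LIMSEQ (\<lambda>n. (1 / real n) \<cdot>\<^sub>m
             (feature_rows (X n \<omega>) I * (feature_rows (X n \<omega>) I)\<^sup>T)) (M I)"
  shows "\<forall>k\<in>{1..L}.
      (\<lambda>n. \<P>(\<omega> in P. k \<le> Lbar n \<omega> \<and> S \<subseteq> \<I> n \<omega> (k - 1) \<longrightarrow>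
         min_emp_risk (X n \<omega>) (y n \<omega>) (\<I> n \<omega> (k - 1)) - min_emp_risk (X n \<omega>) (y n \<omega>) (\<I> n \<omega> k)
           \<le> \<sigma>\<^sup>2 / real n * c * chi_square_1_inv (1 - c\<^sub>1 * (\<sigma>\<^sup>2 / real n)))) \<longlonglongrightarrow> 1
    \<and> (\<lambda>n. \<P>(\<omega> in P. k \<le> Lbar n \<omega> \<and> \<I> n \<omega> (k - 1) \<subset> S \<longrightarrow>
         min_emp_risk (X n \<omega>) (y n \<omega>) (\<I> n \<omega> (k - 1)) - min_emp_risk (X n \<omega>) (y n \<omega>) (\<I> n \<omega> k)
           \<ge> \<sigma>\<^sup>2 / real n * c * chi_square_1_inv (1 - c\<^sub>1 * (\<sigma>\<^sup>2 / real n)))) \<longlonglongrightarrow> 1"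
proof
  fix k assume k: "k \<in> {1..L}"
  interpret prob_space P by fact

  \<comment> \<open>Sigma-algebras of the features and of the noise\<close>
  define F where "F = vimage_algebra (space P)
    (\<lambda>\<omega>. \<lambda>(i, j)\<in>UNIV \<times> {..<L}. x i j \<omega>) (\<Pi>\<^sub>M (i, j)\<in>UNIV \<times> {..<L}. (borel :: real measure))"
  define E where "E = vimage_algebra (space P) (\<lambda>\<omega> i. \<epsilon> i \<omega>) (\<Pi>\<^sub>M i\<in>UNIV. (borel :: real measure))"
  have ind: "indep_set (sets F) (sets E)" unfolding F_def E_def by (rule noise_features_indep)
  have sp: "space F = space P" "space E = space P" by (simp_all add: F_def E_def)
  have subF: "sets F \<subseteq> events" using ind unfolding indep_sets2_eq by auto
  have xF: "(\<lambda>\<omega>. x i j \<omega>) \<in> borel_measurable F" if "j < L" for i j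
  proof -
    have "(\<lambda>\<omega>. \<lambda>(i, j)\<in>UNIV \<times> {..<L}. x i j \<omega>) \<in> measurable F (\<Pi>\<^sub>M (i, j)\<in>UNIV \<times> {..<L}. borel)"
      unfolding F_def by (rule measurable_vimage_algebra1) (auto simp: space_PiM)
    from measurable_compose[OF this measurable_component_singleton[of "(i, j)"]] that
    show ?thesis by simp
  qed
  have \<epsilon>E: "\<epsilon> i \<in> borel_measurable E" for i
  proof -
    have "(\<lambda>\<omega> i. \<epsilon> i \<omega>) \<in> measurable E (\<Pi>\<^sub>M i\<in>UNIV. borel)"
      unfolding E_def by (rule measurable_vimage_algebra1) (auto simp: space_PiM)
    from measurable_compose[OF this measurable_component_singleton[of i]] show ?thesis by simp
  qed
  have \<epsilon>P: "\<epsilon> i \<in> borel_measurable P" for i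
    using distributed_measurable[OF noise_normal] by simp
  have xP: "(\<lambda>\<omega>. x i j \<omega>) \<in> borel_measurable P" if "j < L" for i j
    using measurable_sets[OF xF[OF that]] subF sp by (auto intro!: measurableI)
  define z where "z \<omega> = (\<lambda>i j. x i j \<omega>)" for \<omega>
  define \<beta> where "\<beta> = vec_index \<theta>"
  define r where "r \<omega> i = lin_fit L (z \<omega>) \<beta> i + \<epsilon> i \<omega>" for \<omega> i
  have X: "X n \<omega> = design_mat L n (z \<omega>)" for n \<omega> by (simp add: X_def z_def)
  have y: "y n \<omega> = vec n (r \<omega>)" for n \<omega>
    unfolding y_def X r_def \<beta>_def by (subst response_vec_design_mat) (use assms in auto)
  have L: "0 < L" using assms by auto
  have S: "S \<subseteq> {..<L}" using assms(12) by (auto simp: S_def vec_support_def)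
  have \<beta>S: "\<beta> j = 0" if "j < L" "j \<notin> S" for j
    using that assms(12) by (auto simp: S_def vec_support_def \<beta>_def)

  have mX: "measurable_mat P L n (X n)" for n
    unfolding X[abs_def] by (rule measurable_mat_design_mat) (simp add: z_def xP)
  have my: "measurable_vec P n (y n)" for n
    unfolding measurable_vec_def y r_def lin_fit_def z_def using \<epsilon>P xP by auto
  have rank: "AE \<omega> in P. \<forall>n\<ge>L. full_row_rank L n (z \<omega>)"
    using full_rank unfolding X by eventually_elim (auto intro: full_row_rank_design_mat)

  \<comment> \<open>Almost sure convergence of the full Gram matrix\<close>
  define A where "A = {\<omega>\<in>space F. \<not> (positive_definite_mat L (M {..<L}) \<and>
    (\<forall>i<L. \<forall>j<L. (\<lambda>n. ((1 / real n) \<cdot>\<^sub>m gram_mat L n (z \<omega>)) $$ (i, j)) \<longlonglongrightarrow> M {..<L} $$ (i, j)))}"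
  have "(\<lambda>\<omega>. ((1 / real n) \<cdot>\<^sub>m gram_mat L n (z \<omega>)) $$ (i, j)) \<in> borel_measurable F" if "i < L" "j < L" for n i j
  proof -
    have eq: "((1 / real n) \<cdot>\<^sub>m gram_mat L n (z \<omega>)) $$ (i, j) = 1 / real n * (\<Sum>a<n. x a i \<omega> * x a j \<omega>)" for \<omega>
      using that gram_mat_carrier[of L n "z \<omega>"] by (auto simp: gram_mat_index z_def)
    show ?thesis unfolding eq
      by (intro borel_measurable_times borel_measurable_const borel_measurable_sum xF that)
  qed
  then have A: "A \<in> sets F"
    unfolding A_def by measurable
  have "AE \<omega> in P. \<omega> \<notin> A"
  proof (rule null_of_null_full_path[OF sp ind _ \<epsilon>E assms(9) noise_indep noise_normal L A])
    show "(\<lambda>\<omega>. z \<omega> i j) \<in> borel_measurable F" if "j < L" for i j using xF[OF that] by (simp add: z_def)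
    show "AE \<omega> in P. full_row_rank L L (z \<omega>)" using rank by eventually_elim simp
    show "AE \<omega> in P. sner_Lbar (design_mat L L (z \<omega>)) (vec L (\<lambda>i. lin_fit L (z \<omega>) \<beta> i + \<epsilon> i \<omega>)) (\<tau> L) = L \<longrightarrow> \<omega> \<notin> A"
      using sparse_riesz
    proof eventually_elim
      case (elim \<omega>)
      show ?case
      proof
        assume "sner_Lbar (design_mat L L (z \<omega>)) (vec L (\<lambda>i. lin_fit L (z \<omega>) \<beta> i + \<epsilon> i \<omega>)) (\<tau> L) = L"
        then have "Lbar L \<omega> = L" unfolding Lbar_def X y r_def by simp
        \<comment> \<open>The witness \<open>L\<close> is the smallest sample size at which the
          design matrix has full row rank.\<close>
        then have "\<exists>n\<ge>1. card {..<L} \<le> Lbar n \<omega>" using L by (intro exI[of _ L]) auto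
        with elim have "positive_definite_mat (card {..<L}) (M {..<L}) \<and>
          mat_LIMSEQ (\<lambda>n. (1 / real n) \<cdot>\<^sub>m (feature_rows (X n \<omega>) {..<L} * (feature_rows (X n \<omega>) {..<L})\<^sup>T)) (M {..<L})"
          by blast
        then have pd: "positive_definite_mat L (M {..<L})"
          and lim: "mat_LIMSEQ (\<lambda>n. (1 / real n) \<cdot>\<^sub>m gram_mat L n (z \<omega>)) (M {..<L})"
          unfolding X feature_rows_all gram_mat_def by simp_all
        from pd have "M {..<L} \<in> carrier_mat L L" by (simp add: positive_definite_mat_def)
        then show "\<omega> \<notin> A" using pd lim by (auto simp: A_def mat_LIMSEQ_def)
      qed
    qed
  qed
  then have lim: "AE \<omega> in P. positive_definite_mat L (M {..<L}) \<and>
    (\<forall>i<L. \<forall>j<L. (\<lambda>n. ((1 / real n) \<cdot>\<^sub>m gram_mat L n (z \<omega>)) $$ (i, j)) \<longlonglongrightarrow> M {..<L} $$ (i, j))"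
    using AE_space by eventually_elim (auto simp: A_def sp)
  \<comment> \<open>The matrix does not depend on the outcome, so holding almost surely in a
    probability space means holding.\<close>
  then have pd: "positive_definite_mat L (M {..<L})" by (auto dest: AE_E_prob)

  \<comment> \<open>Noise energy against diverging bounds\<close>
  define H where "H n \<omega> = span_energy L n (z \<omega>) (\<lambda>i. \<epsilon> i \<omega>)" for n \<omega>
  have mH: "H n \<in> borel_measurable P" for n
  proof -
    have "measurable_mat P n n (\<lambda>\<omega>. hat_mat L n (z \<omega>))"
      by (rule measurable_mat_hat_mat[OF measurable_mat_design_mat]) (simp add: z_def xP)
    from measurable_matD(4)[OF this] show ?thesis
      unfolding H_def span_energy_def using \<epsilon>P by (intro borel_measurable_sum borel_measurable_times) auto
  qed
  \<comment> \<open>Used with two bounds: the slowly diverging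
    \<open>\<sigma>\<^sup>2 * c * \<kappa> n\<close> for the first claim and the linear
    \<open>h * real n\<close> for the second.\<close>
  have H_prob: "(\<lambda>n. prob {\<omega>\<in>space P. H n \<omega> < s n}) \<longlonglongrightarrow> 1"
    if s: "filterlim s at_top sequentially" for s
  proof (rule tendsto_sandwich[OF _ _ _ tendsto_const])
    have "(\<lambda>n. \<sigma>\<^sup>2 * real L / s n) \<longlonglongrightarrow> 0"
      by (intro tendsto_divide_0[OF tendsto_const] filterlim_at_top_imp_at_infinity s)
    from tendsto_diff[OF tendsto_const this, of 1]
    show "(\<lambda>n. 1 - \<sigma>\<^sup>2 * real L / s n) \<longlonglongrightarrow> 1" by simp
    show "\<forall>\<^sub>F n in sequentially. 1 - \<sigma>\<^sup>2 * real L / s n \<le> prob {\<omega>\<in>space P. H n \<omega> < s n}"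
      using filterlim_at_top_dense[THEN iffD1, OF s, rule_format, of 0]
    proof eventually_elim
      case (elim n)
      have "prob {\<omega>\<in>space P. s n \<le> H n \<omega>} \<le> \<sigma>\<^sup>2 * real L / s n"
        unfolding H_def
        by (rule span_energy_tail[OF sp ind _ \<epsilon>E normal_noise_moments[OF assms(9) noise_indep noise_normal] elim])
          (simp add: z_def xF)
      moreover have "{\<omega>\<in>space P. H n \<omega> < s n} = space P - {\<omega>\<in>space P. s n \<le> H n \<omega>}" by auto
      ultimately show ?case using prob_compl[of "{\<omega>\<in>space P. s n \<le> H n \<omega>}"] mH[of n] by simp
    qed
  qed simp

  define \<kappa> where "\<kappa> n = chi_square_1_inv (1 - c\<^sub>1 * (\<sigma>\<^sup>2 / real n))" for n
  have a1: "0 < c\<^sub>1 * \<sigma>\<^sup>2" using assms by simp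
  have \<kappa>_top: "filterlim \<kappa> at_top sequentially"
    using chi_square_1_inv_at_top[OF a1] by (simp add: \<kappa>_def[abs_def])
  define dec where "dec n \<omega> = min_emp_risk (X n \<omega>) (y n \<omega>) (\<I> n \<omega> (k - 1)) - min_emp_risk (X n \<omega>) (y n \<omega>) (\<I> n \<omega> k)" for n \<omega>
  have \<I>L: "\<I> n \<omega> (k - 1) \<subseteq> {..<L}" "\<I> n \<omega> k \<subseteq> {..<L}" for n \<omega>
  proof -
    have "k - 1 \<le> L" "k \<le> L" using k by auto
    then show "\<I> n \<omega> (k - 1) \<subseteq> {..<L}" "\<I> n \<omega> k \<subseteq> {..<L}"
      using sner_set_subset_card[OF measurable_matD(2)[OF mX]] unfolding \<I>_def by blast+
  qed
  have [measurable]: "dec n \<in> borel_measurable P" for n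
    unfolding dec_def \<I>_def by (intro borel_measurable_diff borel_measurable_min_emp_risk_sner_set[OF mX my])
  have [measurable]: "Lbar n \<in> measurable P (count_space UNIV)" for n
    unfolding Lbar_def by (rule measurable_sner_Lbar[OF mX my])
  have [measurable]: "Measurable.pred P (\<lambda>\<omega>. Q (\<I> n \<omega> (k - 1)))" for Q n
    unfolding \<I>_def by (rule measurable_compose[OF measurable_sner_set[OF mX my]]) simp

  \<comment> \<open>First claim: the support is already contained in the model\<close>
  have "(\<lambda>n. prob {\<omega>\<in>space P. k \<le> Lbar n \<omega> \<and> S \<subseteq> \<I> n \<omega> (k - 1) \<longrightarrow> dec n \<omega> \<le> \<sigma>\<^sup>2 / real n * c * \<kappa> n}) \<longlonglongrightarrow> 1"
  proof (rule prob_tendsto_1_mono)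
    show "{\<omega>\<in>space P. k \<le> Lbar n \<omega> \<and> S \<subseteq> \<I> n \<omega> (k - 1) \<longrightarrow> dec n \<omega> \<le> \<sigma>\<^sup>2 / real n * c * \<kappa> n} \<in> events" for n
      by measurable
    show "(\<lambda>n. prob {\<omega>\<in>space P. H n \<omega> < \<sigma>\<^sup>2 * c * \<kappa> n}) \<longlonglongrightarrow> 1"
      using assms by (intro H_prob filterlim_tendsto_pos_mult_at_top[OF tendsto_const _ \<kappa>_top]) simp
    show "\<forall>\<^sub>F n in sequentially. AE \<omega> in P. \<omega> \<in> {\<omega>\<in>space P. H n \<omega> < \<sigma>\<^sup>2 * c * \<kappa> n} \<longrightarrow>
      \<omega> \<in> {\<omega>\<in>space P. k \<le> Lbar n \<omega> \<and> S \<subseteq> \<I> n \<omega> (k - 1) \<longrightarrow> dec n \<omega> \<le> \<sigma>\<^sup>2 / real n * c * \<kappa> n}"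
      using eventually_ge_at_top[of L]
    proof eventually_elim
      case (elim n)
      show ?case using rank
      proof eventually_elim
        case (elim \<omega>)
        then have fr: "full_row_rank L n (z \<omega>)" using \<open>L \<le> n\<close> by simp
        have n: "0 < n" using L \<open>L \<le> n\<close> by simp
        have "dec n \<omega> \<le> H n \<omega> / real n" if "S \<subseteq> \<I> n \<omega> (k - 1)"
          unfolding dec_def X y
        proof (rule min_emp_risk_decrease_le[OF fr \<I>L _ _ _ _ n])
          show "r \<omega> i = lin_fit L (z \<omega>) \<beta> i + \<epsilon> i \<omega>" for i by (simp add: r_def)
          show "\<beta> j = 0" if "j < L" "j \<notin> \<I> n \<omega> (k - 1)" for j
            using \<beta>S that \<open>S \<subseteq> \<I> n \<omega> (k - 1)\<close> by auto
          show "span_energy_le L n (z \<omega>) (\<lambda>i. \<epsilon> i \<omega>) (H n \<omega>)"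
            by (rule span_energy_le_span_energy[OF full_row_rank_det_gram[OF fr]]) (simp add: H_def)
          show "0 \<le> H n \<omega>" by (simp add: H_def span_energy_ge_0)
        qed
        moreover have "H n \<omega> / real n \<le> \<sigma>\<^sup>2 / real n * c * \<kappa> n" if "H n \<omega> < \<sigma>\<^sup>2 * c * \<kappa> n"
          using that n by (simp add: divide_right_mono)
        ultimately show ?case by force
      qed
    qed
  qed

  \<comment> \<open>Second claim: the model is strictly contained in the support\<close>
  moreover
  have "(\<lambda>n. prob {\<omega>\<in>space P. k \<le> Lbar n \<omega> \<and> \<I> n \<omega> (k - 1) \<subset> S \<longrightarrow> dec n \<omega> \<ge> \<sigma>\<^sup>2 / real n * c * \<kappa> n}) \<longlonglongrightarrow> 1"
  proof -
    have finS: "finite S" "S \<noteq> {}" using assms S finite_subset by auto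
    define a where "a = Min ((\<lambda>j. \<bar>\<beta> j\<bar>) ` S)"
    define b where "b = Max ((\<lambda>j. \<bar>\<beta> j\<bar>) ` S)"
    have ab: "a \<le> \<bar>\<beta> j\<bar>" "\<bar>\<beta> j\<bar> \<le> b" if "j \<in> S" for j
      using that finS by (auto simp: a_def b_def)
    have "0 < \<bar>\<beta> j\<bar>" if "j \<in> S" for j using that by (auto simp: S_def vec_support_def \<beta>_def)
    then have a: "0 < a" using finS unfolding a_def by (subst Min_gr_iff) auto
    then have b: "0 < b" using ab finS by force
    define g where "g = \<bar>mat_trace (inv_mat (M {..<L}))\<bar> + 1"
    define B where "B = \<bar>mat_trace (M {..<L})\<bar> + 1"
    have gB: "0 < g" "0 < B" by (auto simp: g_def B_def)
    \<comment> \<open>\<open>h\<close> makes \<open>4 * (h * real n) * (g / real n)\<close> equal to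
      \<open>a\<^sup>2\<close>, the largest noise energy that the lower bound tolerates.
      \<open>d\<close> is the resulting decrease: with \<open>g / real n\<close> and
      \<open>real n * B\<close> in place of \<open>g\<close> and \<open>B\<close>, all powers of
      \<open>n\<close> cancel.\<close>
    define h where "h = a\<^sup>2 / (4 * g)"
    define d where "d = (a\<^sup>2 / (2 * g * real L * b))\<^sup>2 / B"
    have h: "0 < h" and d: "0 < d" using a b gB L by (auto simp: h_def d_def)
    define Q where "Q n \<omega> \<longleftrightarrow> mat_trace (inv_mat (gram_mat L n (z \<omega>))) \<le> g / real n \<and>
      mat_trace (gram_mat L n (z \<omega>)) \<le> real n * B" for n \<omega>
    have mQ: "{\<omega>\<in>space P. Q n \<omega>} \<in> events" for n
    proof -
      have G: "measurable_mat P L L (\<lambda>\<omega>. gram_mat L n (z \<omega>))"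
        by (rule measurable_mat_gram_mat[OF measurable_mat_design_mat]) (simp add: z_def xP)
      note [measurable] = borel_measurable_mat_trace[OF G] borel_measurable_mat_trace[OF measurable_inv_mat[OF G]]
      show ?thesis unfolding Q_def by measurable
    qed
    have Mc: "M {..<L} \<in> carrier_mat L L" using pd by (simp add: positive_definite_mat_def)
    have "AE \<omega> in P. \<forall>\<^sub>F n in sequentially. Q n \<omega>"
      using lim rank
    proof eventually_elim
      case (elim \<omega>)
      then show ?case unfolding Q_def g_def B_def
        by (intro gram_trace_bounds[OF Mc positive_definite_det_nonzero[OF pd]])
          (use full_row_rank_det_gram in blast)+
    qed
    then have "(\<lambda>n. prob {\<omega>\<in>space P. Q n \<omega>}) \<longlonglongrightarrow> 1"
      by (rule prob_tendsto_1_of_AE_eventually[OF mQ])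
    moreover have "(\<lambda>n. prob {\<omega>\<in>space P. H n \<omega> < h * real n}) \<longlonglongrightarrow> 1"
      using h by (intro H_prob filterlim_tendsto_pos_mult_at_top[OF tendsto_const] filterlim_real_sequentially)
    moreover have "{\<omega>\<in>space P. H n \<omega> < h * real n} \<in> events" for n using mH[of n] by measurable
    ultimately have G: "(\<lambda>n. prob ({\<omega>\<in>space P. Q n \<omega>} \<inter> {\<omega>\<in>space P. H n \<omega> < h * real n})) \<longlonglongrightarrow> 1"
      using mQ by (intro prob_Int_tendsto_1) auto
    show ?thesis
    proof (rule prob_tendsto_1_mono[OF _ _ G])
      show "{\<omega>\<in>space P. k \<le> Lbar n \<omega> \<and> \<I> n \<omega> (k - 1) \<subset> S \<longrightarrow> dec n \<omega> \<ge> \<sigma>\<^sup>2 / real n * c * \<kappa> n} \<in> events" for n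
        by measurable
      \<comment> \<open>The slope is chosen such that the threshold
        \<open>\<sigma>\<^sup>2 / real n * c * \<kappa> n\<close> falls below
        \<open>d\<close>.\<close>
      have "\<forall>\<^sub>F n in sequentially. \<kappa> n \<le> d / (\<sigma>\<^sup>2 * c) * real n"
        using chi_square_1_inv_sublinear[OF a1, of "d / (\<sigma>\<^sup>2 * c)"] d assms by (simp add: \<kappa>_def)
      then show "\<forall>\<^sub>F n in sequentially. AE \<omega> in P. \<omega> \<in> {\<omega>\<in>space P. Q n \<omega>} \<inter> {\<omega>\<in>space P. H n \<omega> < h * real n} \<longrightarrow>
        \<omega> \<in> {\<omega>\<in>space P. k \<le> Lbar n \<omega> \<and> \<I> n \<omega> (k - 1) \<subset> S \<longrightarrow> dec n \<omega> \<ge> \<sigma>\<^sup>2 / real n * c * \<kappa> n}"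
        using eventually_ge_at_top[of L]
      proof eventually_elim
        case (elim n)
        have n: "0 < n" using L elim by simp
        have "\<sigma>\<^sup>2 / real n * c * \<kappa> n \<le> \<sigma>\<^sup>2 / real n * c * (d / (\<sigma>\<^sup>2 * c) * real n)"
          using elim(1) assms n by (intro mult_left_mono) auto
        also have "\<dots> = d" using assms n by simp
        finally have thr: "\<sigma>\<^sup>2 / real n * c * \<kappa> n \<le> d" .
        show ?case using rank
        proof eventually_elim
          case (elim \<omega>)
          then have fr: "full_row_rank L n (z \<omega>)" using \<open>L \<le> n\<close> by simp
          note det = full_row_rank_det_gram[OF fr]
          have "d \<le> dec n \<omega>" if Q: "Q n \<omega>" and Hn: "H n \<omega> < h * real n" and I: "\<I> n \<omega> (k - 1) \<subset> S"
          proof -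
            have "\<exists>j\<in>S - \<I> n \<omega> (k - 1). (a\<^sup>2 / (2 * (g / real n) * real L * b))\<^sup>2 / (real n * B) / real n
               \<le> min_emp_risk (design_mat L n (z \<omega>)) (vec n (r \<omega>)) (\<I> n \<omega> (k - 1))
                 - min_emp_risk (design_mat L n (z \<omega>)) (vec n (r \<omega>)) (insert j (\<I> n \<omega> (k - 1)))"
            proof (rule min_emp_risk_decrease_ge[OF fr S I \<beta>S ab a])
              show "r \<omega> i = lin_fit L (z \<omega>) \<beta> i + \<epsilon> i \<omega>" for i by (simp add: r_def)
              show "span_energy_le L n (z \<omega>) (\<lambda>i. \<epsilon> i \<omega>) (h * real n)"
                using Hn by (intro span_energy_le_span_energy[OF det]) (simp add: H_def)
              show "0 \<le> h * real n" "0 < g / real n" "0 < real n * B" "0 < n" using h gB n by auto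
              show "(v j)\<^sup>2 \<le> g / real n * (\<Sum>i<n. (lin_fit L (z \<omega>) v i)\<^sup>2)" if "j < L" for v j
                using Q by (intro coeff_bound_mono[OF det that]) (simp add: Q_def)
              show "(\<Sum>i<n. (z \<omega> i j)\<^sup>2) \<le> real n * B" if "j < L" for j
                using Q mat_trace_ge_column_norm[OF that, of "z \<omega>" n] by (simp add: Q_def)
              show "4 * (h * real n) * (g / real n) \<le> a\<^sup>2" using gB n by (simp add: h_def)
            qed
            then obtain j where j: "j \<in> S - \<I> n \<omega> (k - 1)"
              "(a\<^sup>2 / (2 * (g / real n) * real L * b))\<^sup>2 / (real n * B) / real n
               \<le> min_emp_risk (X n \<omega>) (y n \<omega>) (\<I> n \<omega> (k - 1))
                 - min_emp_risk (X n \<omega>) (y n \<omega>) (insert j (\<I> n \<omega> (k - 1)))"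
              unfolding X y by blast
            \<comment> \<open>The procedure may add a feature other than \<open>j\<close>, but then
              its risk is no larger than with \<open>j\<close>.\<close>
            have "min_emp_risk (X n \<omega>) (y n \<omega>) (\<I> n \<omega> (Suc (k - 1)))
                \<le> min_emp_risk (X n \<omega>) (y n \<omega>) (insert j (\<I> n \<omega> (k - 1)))"
              unfolding \<I>_def
              by (rule sner_set_greedy[OF measurable_matD(2)[OF mX]]) (use j(1) S in \<open>auto simp: \<I>_def\<close>)
            moreover have "Suc (k - 1) = k" using k by simp
            moreover have "(a\<^sup>2 / (2 * (g / real n) * real L * b))\<^sup>2 / (real n * B) / real n = d"
              using gB n L b by (simp add: d_def field_simps power2_eq_square)
            ultimately show ?thesis using j(2) unfolding dec_def by simp
          qed
          then show ?case using thr by force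
        qed
      qed
    qed
  qed
  ultimately show "(\<lambda>n. \<P>(\<omega> in P. k \<le> Lbar n \<omega> \<and> S \<subseteq> \<I> n \<omega> (k - 1) \<longrightarrow>
         min_emp_risk (X n \<omega>) (y n \<omega>) (\<I> n \<omega> (k - 1)) - min_emp_risk (X n \<omega>) (y n \<omega>) (\<I> n \<omega> k)
           \<le> \<sigma>\<^sup>2 / real n * c * chi_square_1_inv (1 - c\<^sub>1 * (\<sigma>\<^sup>2 / real n)))) \<longlonglongrightarrow> 1
    \<and> (\<lambda>n. \<P>(\<omega> in P. k \<le> Lbar n \<omega> \<and> \<I> n \<omega> (k - 1) \<subset> S \<longrightarrow>
         min_emp_risk (X n \<omega>) (y n \<omega>) (\<I> n \<omega> (k - 1)) - min_emp_risk (X n \<omega>) (y n \<omega>) (\<I> n \<omega> k)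
           \<ge> \<sigma>\<^sup>2 / real n * c * chi_square_1_inv (1 - c\<^sub>1 * (\<sigma>\<^sup>2 / real n)))) \<longlonglongrightarrow> 1"
    unfolding dec_def \<kappa>_def by blast
qed

end
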